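(* Let $B_{W,0}(\cdot)$ be the $W$-Brownian bridge on $[0,1]$. Then the Cameron--Martin space associated to $B_{W,0}(\cdot)$ is $(H_{W,\mathcal{D}}([0,1]),\langle\cdot,\cdot\rangle_{W,\mathcal{D}})$.
   Context: $W:\mathbb{R}\to\mathbb{R}$ is strictly increasing and càdlàg (right-continuous with left limits), with $W(x+1)-W(x)=W(1)-W(0)$ for all $x$, continuous at $0$ and $W(0)=0$; it may otherwise have jumps. $dW$ is the induced measure, $dW((a,b])=W(b)-W(a)$, and $L^2_{W,0}([0,1])=\{F\in L^2([0,1],dW):\int_{[0,1]}F\,dW=0\}$. The $W$-Brownian bridge $B_{W,0}=(B_{W,0}(t))_{t\in[0,1]}$ is the centered Gaussian process with covariance function $$\varrho_{W,0}(t,s)=W(t\wedge s)-\frac{W(t)W(s)}{W(1)},\qquad s,t\in[0,1].$$ $C_{\mathcal{D}}([0,1])$ is the space of càdlàg functions on $[0,1]$ vanishing at $0$ and $1$, and $$H_{W,\mathcal{D}}([0,1])=\Big\{f\in C_{\mathcal{D}}([0,1]):\ \exists F\in L^2_{W,0}([0,1]),\ f(x)=\int_{(0,x]}F(s)\,dW(s)\ \ \forall x\in[0,1]\Big\}.$$ For such $f$ the function $F$ is unique and is denoted $D^-_Wf$. The inner product is $\langle f,g\rangle_{W,\mathcal{D}}=\int_{[0,1]}D^-_Wf\,D^-_Wg\,dW$. The Cameron--Martin space of a centered Gaussian process $(X_t)_{t\in[0,1]}$ is the Hilbert space of functions $t\mapsto E(\xi X_t)$, where $\xi$ ranges over the closed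 linear span in $L^2(P)$ of $\{X_t:t\in[0,1]\}$, with the inner product making $\xi\mapsto(t\mapsto E(\xi X_t))$ an isometry. *)

theory Defs
  imports "HOL-Probability.Probability"
begin

text \<open>Functions on a set \<open>S\<close> (such as \<open>{0..1}\<close>) are represented as elements of
  \<^const>\<open>extensional\<close> \<open>S\<close>, so that equality of such functions is equality on \<open>S\<close>.\<close>

section \<open>Cadlag functions\<close>

text \<open>At an endpoint of \<open>S\<close> the one-sided filter pointing out of \<open>S\<close> is trivial, so
  nothing is required there.\<close>

definition cadlag_on :: "real set \<Rightarrow> (real \<Rightarrow> real) \<Rightarrow> bool" where
  "cadlag_on S f \<longleftrightarrow>
     (\<forall>x\<in>S. (f \<longlongrightarrow> f x) (at x within S \<inter> {x<..}) \<and>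
            (\<exists>l. (f \<longlongrightarrow> l) (at x within S \<inter> {..<x})))"

definition C_D :: "(real \<Rightarrow> real) set" where
  "C_D = {f \<in> extensional {0..1}. cadlag_on {0..1} f \<and> f 0 = 0 \<and> f 1 = 0}"


section \<open>The space \<open>H\<close> associated with \<open>W\<close>\<close>

text \<open>The measure \<open>dW\<close> is \<^term>\<open>interval_measure W\<close>. Elements of \<open>L\<^sup>2\<close> are represented by
  functions, without passing to classes modulo almost everywhere equality.\<close>

definition L2_W0 :: "(real \<Rightarrow> real) \<Rightarrow> (real \<Rightarrow> real) set" where
  "L2_W0 W = {F. set_borel_measurable (interval_measure W) {0..1} F \<and>
                 set_integrable (interval_measure W) {0..1} (\<lambda>s. (F s)\<^sup>2) \<and>
                 (LINT s:{0..1}|interval_measure W. F s) = 0}"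

definition is_W_derivative :: "(real \<Rightarrow> real) \<Rightarrow> (real \<Rightarrow> real) \<Rightarrow> (real \<Rightarrow> real) \<Rightarrow> bool" where
  "is_W_derivative W f F \<longleftrightarrow>
     F \<in> L2_W0 W \<and> (\<forall>x\<in>{0..1}. f x = (LINT s:{0<..x}|interval_measure W. F s))"

definition H_WD :: "(real \<Rightarrow> real) \<Rightarrow> (real \<Rightarrow> real) set" where
  "H_WD W = {f \<in> C_D. \<exists>F. is_W_derivative W f F}"

text \<open>Being unique only almost everywhere on \<open>[0,1]\<close>, the derivative is given by an arbitrary
  representative; the integral in the inner product does not depend on it.\<close>

definition D_W :: "(real \<Rightarrow> real) \<Rightarrow> (real \<Rightarrow> real) \<Rightarrow> (real \<Rightarrow> real)" where
  "D_W W f = (SOME F. is_W_derivative W f F)"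

definition inner_WD :: "(real \<Rightarrow> real) \<Rightarrow> (real \<Rightarrow> real) \<Rightarrow> (real \<Rightarrow> real) \<Rightarrow> real" where
  "inner_WD W f g = (LINT s:{0..1}|interval_measure W. D_W W f s * D_W W g s)"


section \<open>Centered Gaussian processes\<close>

text \<open>\<^const>\<open>normal_density\<close> needs a positive standard deviation; the first disjunct is the
  degenerate law \<open>N(0,0)\<close>.\<close>

definition centered_gaussian_rv :: "'a measure \<Rightarrow> ('a \<Rightarrow> real) \<Rightarrow> bool" where
  "centered_gaussian_rv M Y \<longleftrightarrow>
     Y \<in> borel_measurable M \<and>
     ((AE \<omega> in M. Y \<omega> = 0) \<or> (\<exists>\<sigma>>0. distributed M lborel Y (normal_density 0 \<sigma>)))"

definition centered_gaussian_process ::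
    "'a measure \<Rightarrow> 'i set \<Rightarrow> ('i \<Rightarrow> 'a \<Rightarrow> real) \<Rightarrow> bool" where
  "centered_gaussian_process M T X \<longleftrightarrow>
     prob_space M \<and>
     (\<forall>S c. finite S \<and> S \<subseteq> T \<longrightarrow> centered_gaussian_rv M (\<lambda>\<omega>. \<Sum>t\<in>S. c t * X t \<omega>))"

definition cov :: "'a measure \<Rightarrow> ('a \<Rightarrow> real) \<Rightarrow> ('a \<Rightarrow> real) \<Rightarrow> real" where
  "cov M Y Z = (\<integral>\<omega>. (Y \<omega> - (\<integral>\<omega>'. Y \<omega>' \<partial>M)) * (Z \<omega> - (\<integral>\<omega>'. Z \<omega>' \<partial>M)) \<partial>M)"

definition rho_W0 :: "(real \<Rightarrow> real) \<Rightarrow> real \<Rightarrow> real \<Rightarrow> real" where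
  "rho_W0 W t s = W (min t s) - W t * W s / W 1"

definition W_brownian_bridge ::
    "(real \<Rightarrow> real) \<Rightarrow> 'a measure \<Rightarrow> (real \<Rightarrow> 'a \<Rightarrow> real) \<Rightarrow> bool" where
  "W_brownian_bridge W M B \<longleftrightarrow>
     centered_gaussian_process M {0..1} B \<and>
     (\<forall>t\<in>{0..1}. \<forall>s\<in>{0..1}. cov M (B t) (B s) = rho_W0 W t s)"


section \<open>The Cameron--Martin space\<close>

text \<open>The closed linear span of \<open>{X t | t \<in> T}\<close> in \<open>L\<^sup>2\<close>, again with functions as
  representatives; the definition presupposes that every \<open>X t\<close> is square integrable.\<close>

definition closed_span_L2 :: "'a measure \<Rightarrow> 'i set \<Rightarrow> ('i \<Rightarrow> 'a \<Rightarrow> real) \<Rightarrow> ('a \<Rightarrow> real) set" where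
  "closed_span_L2 M T X =
     {\<xi> \<in> borel_measurable M. integrable M (\<lambda>\<omega>. (\<xi> \<omega>)\<^sup>2) \<and>
        (\<forall>e>0. \<exists>S c. finite S \<and> S \<subseteq> T \<and>
           sqrt (\<integral>\<omega>. (\<xi> \<omega> - (\<Sum>t\<in>S. c t * X t \<omega>))\<^sup>2 \<partial>M) < e)}"

definition cameron_martin_map ::
    "'a measure \<Rightarrow> 'i set \<Rightarrow> ('i \<Rightarrow> 'a \<Rightarrow> real) \<Rightarrow> ('a \<Rightarrow> real) \<Rightarrow> ('i \<Rightarrow> real)" where
  "cameron_martin_map M T X \<xi> = (\<lambda>t\<in>T. \<integral>\<omega>. \<xi> \<omega> * X t \<omega> \<partial>M)"

definition cameron_martin_space ::
    "'a measure \<Rightarrow> 'i set \<Rightarrow> ('i \<Rightarrow> 'a \<Rightarrow> real) \<Rightarrow> ('i \<Rightarrow> real) set" where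
  "cameron_martin_space M T X = cameron_martin_map M T X ` closed_span_L2 M T X"

text \<open>The map is injective modulo almost everywhere equality, so transporting the \<open>L\<^sup>2\<close> inner
  product through arbitrarily chosen preimages makes it an isometry.\<close>

definition cameron_martin_preimage ::
    "'a measure \<Rightarrow> 'i set \<Rightarrow> ('i \<Rightarrow> 'a \<Rightarrow> real) \<Rightarrow> ('i \<Rightarrow> real) \<Rightarrow> ('a \<Rightarrow> real)" where
  "cameron_martin_preimage M T X f =
     (SOME \<xi>. \<xi> \<in> closed_span_L2 M T X \<and> cameron_martin_map M T X \<xi> = f)"

definition cameron_martin_inner ::
    "'a measure \<Rightarrow> 'i set \<Rightarrow> ('i \<Rightarrow> 'a \<Rightarrow> real) \<Rightarrow> ('i \<Rightarrow> real) \<Rightarrow> ('i \<Rightarrow> real) \<Rightarrow> real" where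
  "cameron_martin_inner M T X f g =
     (\<integral>\<omega>. cameron_martin_preimage M T X f \<omega> * cameron_martin_preimage M T X g \<omega> \<partial>M)"

end

theory Submission
  imports Defs
begin

text \<open>The bridge has a deterministic model. In \<open>L\<^sup>2(dW)\<close>, consider the functions
  \<open>h\<^sub>t = 1\<^bsub>(0,t]\<^esub> - W(t)/W(1) 1\<^bsub>(0,1]\<^esub>\<close> (\<open>bridge_fun\<close>). Their inner products are
  \<open>W(min s t) - W(s)W(t)/W(1)\<close> (\<open>gram_bridge_fun\<close>), which is the covariance of the bridge. Two
  families with the same Gram matrix have isometric closed linear spans, by an isometry that
  preserves the coefficients with respect to the families (\<open>closed_span_L2_transfer\<close>). Hence the
  functions \<open>t \<mapsto> E(\<xi> B\<^sub>t)\<close>, for \<open>\<xi>\<close> in the closed span of the \<open>B\<^sub>t\<close>, are exactly the functions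
  \<open>t \<mapsto> \<integral> \<eta> h\<^sub>t dW\<close>, for \<open>\<eta>\<close> in the closed span of the \<open>h\<^sub>t\<close>, with matching inner products
  (\<open>integral_mult_eq_if_same_coefficients\<close>).

  It remains to identify the model. The closed span of the \<open>h\<^sub>t\<close> consists of the functions of mean
  zero on \<open>(0,1]\<close>: the steps \<open>1\<^bsub>(0,t]\<^esub>\<close> are total in \<open>L\<^sup>2((0,1], dW)\<close> (\<open>L2_in_step_span\<close>), and
  \<open>h\<^sub>t\<close> is the projection of such a step onto the mean-zero functions (\<open>in_bridge_span\<close>,
  \<open>bridge_span_mean_zero\<close>). For \<open>\<eta>\<close> of mean zero, \<open>\<integral> \<eta> h\<^sub>t dW = \<integral>\<^bsub>(0,t]\<^esub> \<eta> dW\<close>, so \<open>\<eta>\<close> is the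
  \<open>W\<close>-derivative of its coefficient function. Such functions are cadlag by dominated convergence
  (\<open>cadlag_on_indefinite_integral\<close>), and they vanish at \<open>0\<close> and \<open>1\<close>.

  The existence of the isometry rests on the completeness of \<open>L\<^sup>2\<close> (\<open>L2_complete\<close>).\<close>

section \<open>Square-integrable functions\<close>

text \<open>The \<open>L\<^sup>2\<close> norm is not given a name. Distances are kept as integrals of squared
  differences, the form in which \<^const>\<open>closed_span_L2\<close> measures approximation.\<close>

definition L2 :: "'a measure \<Rightarrow> ('a \<Rightarrow> real) set" where
  "L2 M = {f \<in> borel_measurable M. integrable M (\<lambda>x. (f x)\<^sup>2)}"

lemma L2_measurable [measurable_dest]: "f \<in> L2 M \<Longrightarrow> f \<in> borel_measurable M"
  by (simp add: L2_def)

lemma L2_integrable_power2: "f \<in> L2 M \<Longrightarrow> integrable M (\<lambda>x. (f x)\<^sup>2)"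
  by (simp add: L2_def)

lemma L2_integrable_mult:
  assumes f: "f \<in> L2 M" and g: "g \<in> L2 M"
  shows "integrable M (\<lambda>x. f x * g x)"
proof (rule Bochner_Integration.integrable_bound)
  show "integrable M (\<lambda>x. (f x)\<^sup>2 + (g x)\<^sup>2)"
    using f g by (simp add: L2_integrable_power2)
  show "(\<lambda>x. f x * g x) \<in> borel_measurable M"
    using f g by (auto simp: L2_def)
  have "\<bar>a * b\<bar> \<le> a\<^sup>2 + b\<^sup>2" for a b :: real
  proof -
    have "2 * (\<bar>a\<bar> * \<bar>b\<bar>) \<le> a\<^sup>2 + b\<^sup>2"
      using sum_squares_bound[of "\<bar>a\<bar>" "\<bar>b\<bar>"] by simp
    moreover have "0 \<le> \<bar>a\<bar> * \<bar>b\<bar>" by simp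
    ultimately show ?thesis unfolding abs_mult by linarith
  qed
  then show "AE x in M. norm (f x * g x) \<le> norm ((f x)\<^sup>2 + (g x)\<^sup>2)"
    by (simp add: abs_of_nonneg)
qed

lemma L2_cmult: "f \<in> L2 M \<Longrightarrow> (\<lambda>x. c * f x) \<in> L2 M"
  by (auto simp: L2_def power_mult_distrib)

lemma L2_add:
  assumes f: "f \<in> L2 M" and g: "g \<in> L2 M"
  shows "(\<lambda>x. f x + g x) \<in> L2 M"
  using L2_integrable_mult[OF f g] f g by (auto simp: L2_def power2_sum mult.assoc)

lemma L2_diff: "f \<in> L2 M \<Longrightarrow> g \<in> L2 M \<Longrightarrow> (\<lambda>x. f x - g x) \<in> L2 M"
  using L2_add[of f M "\<lambda>x. (-1) * g x"] L2_cmult[of g M "-1"] by simp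

lemma L2_zero: "(\<lambda>x. 0) \<in> L2 M"
  by (simp add: L2_def)

lemma L2_lincomb:
  "(\<And>t. t \<in> S \<Longrightarrow> X t \<in> L2 M) \<Longrightarrow> (\<lambda>x. \<Sum>t\<in>S. c t * X t x) \<in> L2 M"
proof (induction S rule: infinite_finite_induct)
  case (insert t S)
  then show ?case
    by (simp add: L2_add L2_cmult)
qed (simp_all add: L2_zero)

text \<open>Replaces the triangle inequality: \<open>(u + v)\<^sup>2 \<le> 2 u\<^sup>2 + 2 v\<^sup>2\<close> avoids square roots, and the
  constant is harmless in every limit argument below.\<close>

lemma integral_power2_diff_le:
  assumes f: "f \<in> L2 M" and g: "g \<in> L2 M" and h: "h \<in> L2 M"
  shows "(\<integral>x. (f x - h x)\<^sup>2 \<partial>M) \<le> 2 * (\<integral>x. (f x - g x)\<^sup>2 \<partial>M) + 2 * (\<integral>x. (g x - h x)\<^sup>2 \<partial>M)"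
proof -
  have int: "integrable M (\<lambda>x. (f x - h x)\<^sup>2)" "integrable M (\<lambda>x. (f x - g x)\<^sup>2)"
    "integrable M (\<lambda>x. (g x - h x)\<^sup>2)"
    using assms by (auto intro: L2_integrable_power2 L2_diff)
  have pt: "(a - c)\<^sup>2 \<le> 2 * (a - b)\<^sup>2 + 2 * (b - c)\<^sup>2" for a b c :: real
    using zero_le_power2[of "(a - b) - (b - c)"] by (simp add: power2_eq_square algebra_simps)
  have "(\<integral>x. (f x - h x)\<^sup>2 \<partial>M) \<le> (\<integral>x. 2 * (f x - g x)\<^sup>2 + 2 * (g x - h x)\<^sup>2 \<partial>M)"
    using int by (intro integral_mono) (auto simp: pt)
  also have "\<dots> = 2 * (\<integral>x. (f x - g x)\<^sup>2 \<partial>M) + 2 * (\<integral>x. (g x - h x)\<^sup>2 \<partial>M)"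
    using int by simp
  finally show ?thesis .
qed

text \<open>The quadratic form \<open>\<integral> (s f - t g)\<^sup>2\<close> in \<open>(s, t)\<close> is nonnegative, so its discriminant is not
  positive.\<close>

lemma L2_Cauchy_Schwarz:
  assumes f: "f \<in> L2 M" and g: "g \<in> L2 M"
  shows "(\<integral>x. f x * g x \<partial>M)\<^sup>2 \<le> (\<integral>x. (f x)\<^sup>2 \<partial>M) * (\<integral>x. (g x)\<^sup>2 \<partial>M)"
proof -
  note int = L2_integrable_power2[OF f] L2_integrable_power2[OF g] L2_integrable_mult[OF f g]
  define a b c where "a = (\<integral>x. (f x)\<^sup>2 \<partial>M)" and "b = (\<integral>x. f x * g x \<partial>M)"
    and "c = (\<integral>x. (g x)\<^sup>2 \<partial>M)"
  have nonneg: "0 \<le> a" "0 \<le> c"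
    unfolding a_def c_def by (simp_all add: integral_nonneg_AE)
  have quad: "0 \<le> s\<^sup>2 * a - 2 * s * t * b + t\<^sup>2 * c" for s t
  proof -
    have "0 \<le> (\<integral>x. (s * f x - t * g x)\<^sup>2 \<partial>M)"
      by simp
    also have "\<dots> = (\<integral>x. s\<^sup>2 * (f x)\<^sup>2 - 2 * s * t * (f x * g x) + t\<^sup>2 * (g x)\<^sup>2 \<partial>M)"
      by (rule arg_cong[where f = "integral\<^sup>L M"]) (auto simp: power2_eq_square algebra_simps)
    also have "\<dots> = s\<^sup>2 * a - 2 * s * t * b + t\<^sup>2 * c"
      using int by (simp add: a_def b_def c_def)
    finally show ?thesis .
  qed
  \<comment> \<open>If \<open>c = 0\<close>, the form is affine in \<open>t\<close>, and a nonconstant affine function takes negative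
    values; otherwise its value at \<open>(c, b)\<close> is \<open>c\<close> times the discriminant gap.\<close>
  have "b\<^sup>2 \<le> a * c"
  proof (cases "c = 0")
    case True
    have "2 * (s * b) \<le> a" for s
      using quad[of 1 s] True by simp
    from this[of "(a + 1) / (2 * b)"] have "b = 0"
      by (cases "b = 0") auto
    then show ?thesis using True by simp
  next
    case False
    have "0 \<le> c * (a * c - b\<^sup>2)"
      using quad[of c b] by (simp add: power2_eq_square algebra_simps)
    with False nonneg show ?thesis
      by (simp add: zero_le_mult_iff)
  qed
  then show ?thesis by (simp add: a_def b_def c_def)
qed

definition L2_tendsto :: "'a measure \<Rightarrow> (nat \<Rightarrow> 'a \<Rightarrow> real) \<Rightarrow> ('a \<Rightarrow> real) \<Rightarrow> bool" where
  "L2_tendsto M p f \<longleftrightarrow> (\<lambda>n. \<integral>x. (f x - p n x)\<^sup>2 \<partial>M) \<longlonglongrightarrow> 0"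

text \<open>Continuity of the inner product, by Cauchy--Schwarz applied to \<open>f - p n\<close> and \<open>g\<close>.\<close>

lemma L2_tendsto_integral_mult:
  assumes f: "f \<in> L2 M" and p: "\<And>n. p n \<in> L2 M" and g: "g \<in> L2 M"
    and lim: "L2_tendsto M p f"
  shows "(\<lambda>n. \<integral>x. p n x * g x \<partial>M) \<longlonglongrightarrow> (\<integral>x. f x * g x \<partial>M)"
proof -
  have "(\<lambda>n. (\<integral>x. f x * g x \<partial>M) - (\<integral>x. p n x * g x \<partial>M)) \<longlonglongrightarrow> 0"
  proof (rule Lim_null_comparison)
    show "(\<lambda>n. sqrt ((\<integral>x. (f x - p n x)\<^sup>2 \<partial>M) * (\<integral>x. (g x)\<^sup>2 \<partial>M))) \<longlonglongrightarrow> 0"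
      using tendsto_real_sqrt[OF tendsto_mult_left_zero[OF lim[unfolded L2_tendsto_def]]] by simp
    have "norm ((\<integral>x. f x * g x \<partial>M) - (\<integral>x. p n x * g x \<partial>M))
        \<le> sqrt ((\<integral>x. (f x - p n x)\<^sup>2 \<partial>M) * (\<integral>x. (g x)\<^sup>2 \<partial>M))" for n
    proof -
      have "(\<integral>x. f x * g x \<partial>M) - (\<integral>x. p n x * g x \<partial>M) = (\<integral>x. (f x - p n x) * g x \<partial>M)"
        using L2_integrable_mult[OF f g] L2_integrable_mult[OF p g]
        by (simp add: left_diff_distrib)
      then show ?thesis
        using L2_Cauchy_Schwarz[OF L2_diff[OF f p] g, of n] by (simp add: real_le_rsqrt)
    qed
    then show "\<forall>\<^sub>F n in sequentially. norm ((\<integral>x. f x * g x \<partial>M) - (\<integral>x. p n x * g x \<partial>M))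
        \<le> sqrt ((\<integral>x. (f x - p n x)\<^sup>2 \<partial>M) * (\<integral>x. (g x)\<^sup>2 \<partial>M))"
      by simp
  qed
  from tendsto_diff[OF tendsto_const[of "\<integral>x. f x * g x \<partial>M"] this] show ?thesis by simp
qed

text \<open>The measure may be infinite, so \<open>L\<^sup>2\<close> bounds give no \<open>L\<^sup>1\<close> bounds. Instead
  \<open>\<bar>d\<bar> \<le> 2\<^sup>-\<^sup>n + 2\<^sup>n d\<^sup>2\<close> bounds each term by a summable constant and a function whose integral
  is at most \<open>2\<^sup>-\<^sup>n\<close>; by monotone convergence the sum of these functions is finite almost
  everywhere.\<close>

lemma AE_summable_if_L2_geometric:
  assumes d: "\<And>n. d n \<in> L2 M" and small: "\<And>n. (\<integral>x. (d n x)\<^sup>2 \<partial>M) \<le> (1/4) ^ n"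
  shows "AE x in M. summable (\<lambda>n. d n x)"
proof -
  have [measurable]: "\<And>n. d n \<in> borel_measurable M"
    using d by (simp add: L2_def)
  have "(\<integral>\<^sup>+x. (\<Sum>n. ennreal (2 ^ n * (d n x)\<^sup>2)) \<partial>M) = (\<Sum>n. \<integral>\<^sup>+x. ennreal (2 ^ n * (d n x)\<^sup>2) \<partial>M)"
    by (rule nn_integral_suminf) simp
  also have "\<dots> = (\<Sum>n. ennreal (2 ^ n * (\<integral>x. (d n x)\<^sup>2 \<partial>M)))"
  proof (rule arg_cong[where f = suminf], rule ext)
    fix n
    show "(\<integral>\<^sup>+x. ennreal (2 ^ n * (d n x)\<^sup>2) \<partial>M) = ennreal (2 ^ n * (\<integral>x. (d n x)\<^sup>2 \<partial>M))"
      using L2_integrable_power2[OF d] by (subst nn_integral_eq_integral) auto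
  qed
  also have "\<dots> \<le> (\<Sum>n. ennreal ((1/2) ^ n))"
  proof (intro suminf_le ennreal_leI)
    fix n
    have "2 ^ n * (\<integral>x. (d n x)\<^sup>2 \<partial>M) \<le> 2 ^ n * (1/4) ^ n"
      using small by simp
    also have "\<dots> = (1/2) ^ n"
      by (simp add: power_mult_distrib[symmetric])
    finally show "2 ^ n * (\<integral>x. (d n x)\<^sup>2 \<partial>M) \<le> (1/2) ^ n" .
  qed auto
  also have "\<dots> = ennreal (\<Sum>n. (1/2) ^ n)"
    by (rule suminf_ennreal2) (auto intro: summable_geometric)
  finally have "(\<integral>\<^sup>+x. (\<Sum>n. ennreal (2 ^ n * (d n x)\<^sup>2)) \<partial>M) \<noteq> \<infinity>"
    using ennreal_less_top le_less_trans by (metis infinity_ennreal_def less_irrefl)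
  then have "AE x in M. (\<Sum>n. ennreal (2 ^ n * (d n x)\<^sup>2)) \<noteq> \<infinity>"
    by (intro nn_integral_PInf_AE) auto
  then show ?thesis
  proof eventually_elim
    case (elim x)
    then have s: "summable (\<lambda>n. 2 ^ n * (d n x)\<^sup>2)"
      by (intro summable_suminf_not_top) auto
    show "summable (\<lambda>n. d n x)"
    proof (rule summable_comparison_test')
      show "summable (\<lambda>n. (1/2) ^ n + 2 ^ n * (d n x)\<^sup>2)"
        by (intro summable_add s summable_geometric) simp
      fix n
      define u v where "u = (1/2::real) ^ n" and "v = \<bar>d n x\<bar>"
      have "0 < u" unfolding u_def by simp
      have "0 \<le> u * v" using \<open>0 < u\<close> by (simp add: v_def)
      then have "u * v \<le> u\<^sup>2 + v\<^sup>2"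
        using sum_squares_bound[of u v] by linarith
      then have "v \<le> u + v\<^sup>2 / u"
        using \<open>0 < u\<close> by (simp add: field_simps power2_eq_square)
      then show "norm (d n x) \<le> (1/2) ^ n + 2 ^ n * (d n x)\<^sup>2"
        by (simp add: u_def v_def power_one_over field_simps)
    qed
  qed
qed

text \<open>Completeness of \<open>L\<^sup>2\<close> for sequences that are Cauchy at a geometric rate, which the
  approximating sequences below satisfy by choice. Such a sequence converges almost everywhere,
  and Fatou's lemma turns the Cauchy estimate into an estimate of the distance to the limit.\<close>

lemma L2_complete:
  assumes q: "\<And>n. q n \<in> L2 M"
    and cauchy: "\<And>m n. n \<le> m \<Longrightarrow> (\<integral>x. (q m x - q n x)\<^sup>2 \<partial>M) \<le> (1/4) ^ n"
  obtains f where "f \<in> L2 M" "L2_tendsto M q f"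
proof -
  have [measurable]: "\<And>n. q n \<in> borel_measurable M"
    using q by (simp add: L2_def)
  define f where "f x = lim (\<lambda>n. q n x)" for x
  have [measurable]: "f \<in> borel_measurable M"
    unfolding f_def by measurable
  have "AE x in M. summable (\<lambda>n. q (Suc n) x - q n x)"
    by (rule AE_summable_if_L2_geometric) (auto intro: L2_diff q cauchy)
  then have conv: "AE x in M. (\<lambda>n. q n x) \<longlonglongrightarrow> f x"
  proof eventually_elim
    case (elim x)
    then have "convergent (\<lambda>n. q n x)"
      unfolding summable_iff_convergent
      using convergent_add_const_iff[of "- q 0 x" "\<lambda>n. q n x"] by (simp add: sum_lessThan_telescope[of "\<lambda>n. q n x"])
    then show ?case
      by (simp add: f_def convergent_LIMSEQ_iff)
  qed
  have bound: "(\<integral>\<^sup>+x. ennreal ((f x - q n x)\<^sup>2) \<partial>M) \<le> ennreal ((1/4) ^ n)" for n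
  proof -
    have "(\<integral>\<^sup>+x. ennreal ((f x - q n x)\<^sup>2) \<partial>M)
        = (\<integral>\<^sup>+x. liminf (\<lambda>m. ennreal ((q m x - q n x)\<^sup>2)) \<partial>M)"
    proof (rule nn_integral_cong_AE, use conv in eventually_elim)
      case (elim x)
      then have "(\<lambda>m. ennreal ((q m x - q n x)\<^sup>2)) \<longlonglongrightarrow> ennreal ((f x - q n x)\<^sup>2)"
        by (intro tendsto_intros)
      then show ?case
        by (intro lim_imp_Liminf[symmetric]) auto
    qed
    also have "\<dots> \<le> liminf (\<lambda>m. \<integral>\<^sup>+x. ennreal ((q m x - q n x)\<^sup>2) \<partial>M)"
      by (rule nn_integral_liminf) simp
    also have "\<dots> \<le> liminf (\<lambda>m. ennreal ((1/4) ^ n))"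
    proof (rule Liminf_mono, rule eventually_mono[OF eventually_ge_at_top[of n]])
      fix m assume "n \<le> m"
      then show "(\<integral>\<^sup>+x. ennreal ((q m x - q n x)\<^sup>2) \<partial>M) \<le> ennreal ((1/4) ^ n)"
        using L2_integrable_power2[OF L2_diff[OF q q]] cauchy
        by (subst nn_integral_eq_integral) (auto intro: ennreal_leI)
    qed
    also have "\<dots> = ennreal ((1/4) ^ n)"
      by (simp add: Liminf_const)
    finally show ?thesis .
  qed
  have fq: "(\<lambda>x. f x - q n x) \<in> L2 M" for n
    unfolding L2_def using bound[of n]
    by (auto intro!: integrableI_bounded intro: le_less_trans[OF _ ennreal_less_top])
  have "f \<in> L2 M"
    using L2_add[OF fq[of 0] q[of 0]] by simp
  moreover have "L2_tendsto M q f"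
    unfolding L2_tendsto_def
  proof (rule tendsto_sandwich[OF _ _ tendsto_const])
    show "(\<lambda>n. (1/4::real) ^ n) \<longlonglongrightarrow> 0"
      by (rule LIMSEQ_power_zero) simp
    have "(\<integral>x. (f x - q n x)\<^sup>2 \<partial>M) \<le> (1/4) ^ n" for n
      using bound[of n] L2_integrable_power2[OF fq[of n]] by (subst (asm) nn_integral_eq_integral) auto
    then show "\<forall>\<^sub>F n in sequentially. (\<integral>x. (f x - q n x)\<^sup>2 \<partial>M) \<le> (1/4) ^ n"
      by simp
  qed simp
  ultimately show thesis by (rule that)
qed

section \<open>Closed linear spans\<close>

lemma closed_span_L2_subset_L2: "\<xi> \<in> closed_span_L2 M T X \<Longrightarrow> \<xi> \<in> L2 M"
  by (simp add: closed_span_L2_def L2_def)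

lemma closed_span_L2_approx:
  assumes "\<xi> \<in> closed_span_L2 M T X" and "0 < e"
  obtains S c where "finite S" "S \<subseteq> T" "(\<integral>\<omega>. (\<xi> \<omega> - (\<Sum>t\<in>S. c t * X t \<omega>))\<^sup>2 \<partial>M) < e"
proof -
  have "\<exists>S c. finite S \<and> S \<subseteq> T \<and> sqrt (\<integral>\<omega>. (\<xi> \<omega> - (\<Sum>t\<in>S. c t * X t \<omega>))\<^sup>2 \<partial>M) < sqrt e"
    using assms unfolding closed_span_L2_def by (elim CollectE conjE allE[of _ "sqrt e"]) simp
  then obtain S c where "finite S" "S \<subseteq> T"
    "sqrt (\<integral>\<omega>. (\<xi> \<omega> - (\<Sum>t\<in>S. c t * X t \<omega>))\<^sup>2 \<partial>M) < sqrt e"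
    by (elim exE conjE)
  then show thesis
    by (intro that[of S c]) simp_all
qed

lemma closed_span_L2I:
  assumes "\<xi> \<in> L2 M"
    and approx: "\<And>e. 0 < e \<Longrightarrow> \<exists>S c. finite S \<and> S \<subseteq> T \<and> (\<integral>\<omega>. (\<xi> \<omega> - (\<Sum>t\<in>S. c t * X t \<omega>))\<^sup>2 \<partial>M) < e"
  shows "\<xi> \<in> closed_span_L2 M T X"
proof -
  have "\<exists>S c. finite S \<and> S \<subseteq> T \<and> sqrt (\<integral>\<omega>. (\<xi> \<omega> - (\<Sum>t\<in>S. c t * X t \<omega>))\<^sup>2 \<partial>M) < e" if "0 < e" for e
  proof -
    obtain S c where "finite S" "S \<subseteq> T" "(\<integral>\<omega>. (\<xi> \<omega> - (\<Sum>t\<in>S. c t * X t \<omega>))\<^sup>2 \<partial>M) < e\<^sup>2"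
      using approx[OF zero_less_power[OF \<open>0 < e\<close>, of 2]] by (elim exE conjE)
    moreover from this(3) have "sqrt (\<integral>\<omega>. (\<xi> \<omega> - (\<Sum>t\<in>S. c t * X t \<omega>))\<^sup>2 \<partial>M) < e"
      using \<open>0 < e\<close> by (simp add: real_less_lsqrt)
    ultimately show ?thesis
      by (intro exI[of _ S] exI[of _ c]) simp
  qed
  then show ?thesis
    using assms(1) by (simp add: closed_span_L2_def L2_def)
qed

lemma closed_span_L2_lincomb:
  assumes "\<And>t. t \<in> T \<Longrightarrow> X t \<in> L2 M" and "finite S" "S \<subseteq> T"
  shows "(\<lambda>\<omega>. \<Sum>t\<in>S. c t * X t \<omega>) \<in> closed_span_L2 M T X"
proof (rule closed_span_L2I)
  show "(\<lambda>\<omega>. \<Sum>t\<in>S. c t * X t \<omega>) \<in> L2 M"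
    using assms by (intro L2_lincomb) auto
  show "\<exists>S' c'. finite S' \<and> S' \<subseteq> T \<and>
      (\<integral>\<omega>. ((\<Sum>t\<in>S. c t * X t \<omega>) - (\<Sum>t\<in>S'. c' t * X t \<omega>))\<^sup>2 \<partial>M) < e" if "0 < e" for e
    using assms that by (intro exI[of _ S] exI[of _ c]) simp
qed

lemma closed_span_L2_zero: "(\<And>t. t \<in> T \<Longrightarrow> X t \<in> L2 M) \<Longrightarrow> (\<lambda>\<omega>. 0) \<in> closed_span_L2 M T X"
  using closed_span_L2_lincomb[of T X M "{}"] by simp

lemma closed_span_L2_closed:
  assumes X: "\<And>t. t \<in> T \<Longrightarrow> X t \<in> L2 M" and \<xi>: "\<xi> \<in> L2 M"
    and q: "\<And>n. q n \<in> closed_span_L2 M T X" and lim: "L2_tendsto M q \<xi>"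
  shows "\<xi> \<in> closed_span_L2 M T X"
proof (rule closed_span_L2I[OF \<xi>])
  fix e :: real assume "0 < e"
  then have "\<forall>\<^sub>F n in sequentially. (\<integral>\<omega>. (\<xi> \<omega> - q n \<omega>)\<^sup>2 \<partial>M) < e / 4"
    using lim unfolding L2_tendsto_def by (intro order_tendstoD) auto
  then obtain n where n: "(\<integral>\<omega>. (\<xi> \<omega> - q n \<omega>)\<^sup>2 \<partial>M) < e / 4"
    by (auto simp: eventually_sequentially)
  obtain S c where S: "finite S" "S \<subseteq> T" "(\<integral>\<omega>. (q n \<omega> - (\<Sum>t\<in>S. c t * X t \<omega>))\<^sup>2 \<partial>M) < e / 4"
    using closed_span_L2_approx[OF q, of "e/4"] \<open>0 < e\<close> by auto
  have "(\<lambda>\<omega>. \<Sum>t\<in>S. c t * X t \<omega>) \<in> L2 M"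
    using X S by (intro L2_lincomb) auto
  from integral_power2_diff_le[OF \<xi> closed_span_L2_subset_L2[OF q, of n] this] n S
  have "(\<integral>\<omega>. (\<xi> \<omega> - (\<Sum>t\<in>S. c t * X t \<omega>))\<^sup>2 \<partial>M) < e"
    by simp
  with S show "\<exists>S c. finite S \<and> S \<subseteq> T \<and> (\<integral>\<omega>. (\<xi> \<omega> - (\<Sum>t\<in>S. c t * X t \<omega>))\<^sup>2 \<partial>M) < e"
    by blast
qed

lemma closed_span_L2_approx_sequence:
  assumes "\<xi> \<in> closed_span_L2 M T X" and r: "\<And>n. 0 < r n"
  obtains S c where "\<And>n::nat. finite (S n)" "\<And>n. S n \<subseteq> T"
    "\<And>n. (\<integral>\<omega>. (\<xi> \<omega> - (\<Sum>t\<in>S n. c n t * X t \<omega>))\<^sup>2 \<partial>M) < r n"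
proof -
  have "\<forall>n. \<exists>S c. finite S \<and> S \<subseteq> T \<and> (\<integral>\<omega>. (\<xi> \<omega> - (\<Sum>t\<in>S. c t * X t \<omega>))\<^sup>2 \<partial>M) < r n"
  proof
    fix n
    obtain S c where "finite S" "S \<subseteq> T" "(\<integral>\<omega>. (\<xi> \<omega> - (\<Sum>t\<in>S. c t * X t \<omega>))\<^sup>2 \<partial>M) < r n"
      by (rule closed_span_L2_approx[OF assms(1) r])
    then show "\<exists>S c. finite S \<and> S \<subseteq> T \<and> (\<integral>\<omega>. (\<xi> \<omega> - (\<Sum>t\<in>S. c t * X t \<omega>))\<^sup>2 \<partial>M) < r n"
      by (intro exI[of _ S] exI[of _ c]) simp
  qed
  from choice[OF this] obtain S where "\<forall>n. \<exists>c. finite (S n) \<and> S n \<subseteq> T \<and>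
      (\<integral>\<omega>. (\<xi> \<omega> - (\<Sum>t\<in>S n. c t * X t \<omega>))\<^sup>2 \<partial>M) < r n" ..
  from choice[OF this] obtain c where "\<forall>n. finite (S n) \<and> S n \<subseteq> T \<and>
      (\<integral>\<omega>. (\<xi> \<omega> - (\<Sum>t\<in>S n. c n t * X t \<omega>))\<^sup>2 \<partial>M) < r n" ..
  then show thesis
    by (intro that[of S c]) simp_all
qed

lemma closed_span_L2_add:
  assumes X: "\<And>t. t \<in> T \<Longrightarrow> X t \<in> L2 M"
    and \<xi>: "\<xi> \<in> closed_span_L2 M T X" and \<eta>: "\<eta> \<in> closed_span_L2 M T X"
  shows "(\<lambda>\<omega>. \<xi> \<omega> + \<eta> \<omega>) \<in> closed_span_L2 M T X"
proof (rule closed_span_L2I)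
  note L = closed_span_L2_subset_L2[OF \<xi>] closed_span_L2_subset_L2[OF \<eta>]
  show sum: "(\<lambda>\<omega>. \<xi> \<omega> + \<eta> \<omega>) \<in> L2 M"
    by (intro L2_add L)
  fix e :: real assume "0 < e"
  then have e: "0 < e / 4" by simp
  obtain S c where S: "finite S" "S \<subseteq> T" "(\<integral>\<omega>. (\<xi> \<omega> - (\<Sum>t\<in>S. c t * X t \<omega>))\<^sup>2 \<partial>M) < e / 4"
    by (rule closed_span_L2_approx[OF \<xi> e])
  obtain S' c' where S': "finite S'" "S' \<subseteq> T" "(\<integral>\<omega>. (\<eta> \<omega> - (\<Sum>t\<in>S'. c' t * X t \<omega>))\<^sup>2 \<partial>M) < e / 4"
    by (rule closed_span_L2_approx[OF \<eta> e])
  \<comment> \<open>The two combinations are merged over the union of their index sets, which may overlap.\<close>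
  define d where "d t = (if t \<in> S then c t else 0) + (if t \<in> S' then c' t else 0)" for t
  have d: "(\<Sum>t\<in>S \<union> S'. d t * X t \<omega>) = (\<Sum>t\<in>S. c t * X t \<omega>) + (\<Sum>t\<in>S'. c' t * X t \<omega>)" for \<omega>
  proof -
    have "(\<Sum>t\<in>S \<union> S'. (if t \<in> S then c t else 0) * X t \<omega>) = (\<Sum>t\<in>S. c t * X t \<omega>)"
      using S S' by (intro sum.mono_neutral_cong_right) auto
    moreover have "(\<Sum>t\<in>S \<union> S'. (if t \<in> S' then c' t else 0) * X t \<omega>) = (\<Sum>t\<in>S'. c' t * X t \<omega>)"
      using S S' by (intro sum.mono_neutral_cong_right) auto
    ultimately show ?thesis
      by (simp add: d_def distrib_right sum.distrib)
  qed
  have p: "(\<lambda>\<omega>. \<Sum>t\<in>S. c t * X t \<omega>) \<in> L2 M" and p': "(\<lambda>\<omega>. \<Sum>t\<in>S'. c' t * X t \<omega>) \<in> L2 M"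
    using X S S' by (auto intro!: L2_lincomb)
  have "(\<integral>\<omega>. (\<xi> \<omega> + \<eta> \<omega> - (\<Sum>t\<in>S \<union> S'. d t * X t \<omega>))\<^sup>2 \<partial>M) < e"
    using integral_power2_diff_le[OF sum L2_add[OF p L(2)] L2_add[OF p p']] S S'
    by (simp add: d)
  then show "\<exists>S c. finite S \<and> S \<subseteq> T \<and> (\<integral>\<omega>. (\<xi> \<omega> + \<eta> \<omega> - (\<Sum>t\<in>S. c t * X t \<omega>))\<^sup>2 \<partial>M) < e"
    using S S' by (intro exI[of _ "S \<union> S'"] exI[of _ d]) simp
qed

text \<open>The error is scaled by \<open>a\<^sup>2\<close>; dividing the tolerance by \<open>a\<^sup>2 + 1\<close> instead covers \<open>a = 0\<close>.\<close>

lemma closed_span_L2_cmult: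
  assumes X: "\<And>t. t \<in> T \<Longrightarrow> X t \<in> L2 M" and \<xi>: "\<xi> \<in> closed_span_L2 M T X"
  shows "(\<lambda>\<omega>. a * \<xi> \<omega>) \<in> closed_span_L2 M T X"
proof (rule closed_span_L2I)
  show "(\<lambda>\<omega>. a * \<xi> \<omega>) \<in> L2 M"
    by (intro L2_cmult closed_span_L2_subset_L2[OF \<xi>])
  fix e :: real assume "0 < e"
  have pos: "0 < a\<^sup>2 + 1" by (simp add: add_nonneg_pos)
  obtain S c where S: "finite S" "S \<subseteq> T" 
    and le: "(\<integral>\<omega>. (\<xi> \<omega> - (\<Sum>t\<in>S. c t * X t \<omega>))\<^sup>2 \<partial>M) < e / (a\<^sup>2 + 1)"
    using closed_span_L2_approx[OF \<xi>, of "e / (a\<^sup>2 + 1)"] \<open>0 < e\<close> pos by auto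
  have "(\<integral>\<omega>. (a * \<xi> \<omega> - (\<Sum>t\<in>S. (a * c t) * X t \<omega>))\<^sup>2 \<partial>M)
      = (\<integral>\<omega>. a\<^sup>2 * (\<xi> \<omega> - (\<Sum>t\<in>S. c t * X t \<omega>))\<^sup>2 \<partial>M)"
    by (simp add: power_mult_distrib[symmetric] right_diff_distrib sum_distrib_left mult.assoc)
  also have "\<dots> = a\<^sup>2 * (\<integral>\<omega>. (\<xi> \<omega> - (\<Sum>t\<in>S. c t * X t \<omega>))\<^sup>2 \<partial>M)"
    by simp
  also have "\<dots> \<le> (a\<^sup>2 + 1) * (\<integral>\<omega>. (\<xi> \<omega> - (\<Sum>t\<in>S. c t * X t \<omega>))\<^sup>2 \<partial>M)"
    by (intro mult_right_mono) auto
  also have "\<dots> < e"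
    using le pos by (simp add: field_simps)
  finally show "\<exists>S c. finite S \<and> S \<subseteq> T \<and> (\<integral>\<omega>. (a * \<xi> \<omega> - (\<Sum>t\<in>S. c t * X t \<omega>))\<^sup>2 \<partial>M) < e"
    using S by (intro exI[of _ S] exI[of _ "\<lambda>t. a * c t"]) simp
qed

section \<open>Families with the same Gram matrix\<close>

lemma integral_mult_lincomb:
  assumes "\<And>t. t \<in> S \<Longrightarrow> X t \<in> L2 M" and "\<xi> \<in> L2 M"
  shows "(\<integral>\<omega>. (\<Sum>t\<in>S. c t * X t \<omega>) * \<xi> \<omega> \<partial>M) = (\<Sum>t\<in>S. c t * (\<integral>\<omega>. \<xi> \<omega> * X t \<omega> \<partial>M))"
proof -
  have "(\<integral>\<omega>. (\<Sum>t\<in>S. c t * X t \<omega>) * \<xi> \<omega> \<partial>M) = (\<integral>\<omega>. (\<Sum>t\<in>S. c t * (\<xi> \<omega> * X t \<omega>)) \<partial>M)"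
    by (simp add: sum_distrib_left sum_distrib_right ac_simps)
  also have "\<dots> = (\<Sum>t\<in>S. c t * (\<integral>\<omega>. \<xi> \<omega> * X t \<omega> \<partial>M))"
    using assms by (subst Bochner_Integration.integral_sum) (auto intro: L2_integrable_mult)
  finally show ?thesis .
qed

text \<open>Both sides are the same quadratic form in the coefficients, evaluated on equal Gram matrices:
  \<open>X t \<mapsto> Y t\<close> is an isometry of the algebraic spans.\<close>

lemma integral_power2_lincomb_diff:
  fixes X :: "'i \<Rightarrow> 'a \<Rightarrow> real" and Y :: "'i \<Rightarrow> 'b \<Rightarrow> real"
  assumes "\<And>t. t \<in> T \<Longrightarrow> X t \<in> L2 M" "\<And>t. t \<in> T \<Longrightarrow> Y t \<in> L2 N"
    and gram: "\<And>s t. s \<in> T \<Longrightarrow> t \<in> T \<Longrightarrow> (\<integral>\<omega>. X s \<omega> * X t \<omega> \<partial>M) = (\<integral>\<omega>. Y s \<omega> * Y t \<omega> \<partial>N)"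
    and S: "S \<subseteq> T" "S' \<subseteq> T"
  shows "(\<integral>\<omega>. ((\<Sum>t\<in>S. c t * X t \<omega>) - (\<Sum>t\<in>S'. d t * X t \<omega>))\<^sup>2 \<partial>M)
       = (\<integral>\<omega>. ((\<Sum>t\<in>S. c t * Y t \<omega>) - (\<Sum>t\<in>S'. d t * Y t \<omega>))\<^sup>2 \<partial>N)"
proof -
  have ip: "(\<integral>\<omega>. (\<Sum>t\<in>A. a t * X t \<omega>) * (\<Sum>t\<in>A'. a' t * X t \<omega>) \<partial>M)
      = (\<integral>\<omega>. (\<Sum>t\<in>A. a t * Y t \<omega>) * (\<Sum>t\<in>A'. a' t * Y t \<omega>) \<partial>N)"
    if A: "A \<subseteq> T" "A' \<subseteq> T" for A A' and a a' :: "'i \<Rightarrow> real"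
  proof -
    have double_sum: "(\<integral>\<omega>. (\<Sum>t\<in>A. a t * Z t \<omega>) * (\<Sum>t\<in>A'. a' t * Z t \<omega>) \<partial>K)
        = (\<Sum>t\<in>A. a t * (\<Sum>s\<in>A'. a' s * (\<integral>\<omega>. Z t \<omega> * Z s \<omega> \<partial>K)))"
      if Z: "\<And>t. t \<in> T \<Longrightarrow> Z t \<in> L2 K" for Z and K :: "'z measure"
    proof -
      have A_L2: "Z t \<in> L2 K" if "t \<in> A" for t
        using A Z that by auto
      have A'_L2: "Z t \<in> L2 K" if "t \<in> A'" for t
        using A Z that by auto
      show ?thesis
        by (simp add: integral_mult_lincomb A_L2 A'_L2 L2_lincomb)
    qed
    have "(\<Sum>t\<in>A. a t * (\<Sum>s\<in>A'. a' s * (\<integral>\<omega>. X t \<omega> * X s \<omega> \<partial>M)))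
        = (\<Sum>t\<in>A. a t * (\<Sum>s\<in>A'. a' s * (\<integral>\<omega>. Y t \<omega> * Y s \<omega> \<partial>N)))"
      using A gram by (intro sum.cong arg_cong2[where f = "(*)"] refl) auto
    then show ?thesis
      by (simp only: double_sum[of X M, OF assms(1)] double_sum[of Y N, OF assms(2)])
  qed
  have expand: "(\<integral>\<omega>. (f \<omega> - g \<omega>)\<^sup>2 \<partial>K) = (\<integral>\<omega>. f \<omega> * f \<omega> \<partial>K) - 2 * (\<integral>\<omega>. f \<omega> * g \<omega> \<partial>K) + (\<integral>\<omega>. g \<omega> * g \<omega> \<partial>K)"
    if "f \<in> L2 K" "g \<in> L2 K" for f g and K :: "'z measure"
  proof -
    have "(\<integral>\<omega>. (f \<omega> - g \<omega>)\<^sup>2 \<partial>K) = (\<integral>\<omega>. f \<omega> * f \<omega> - 2 * (f \<omega> * g \<omega>) + g \<omega> * g \<omega> \<partial>K)"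
      by (rule arg_cong[where f = "integral\<^sup>L K"]) (auto simp: power2_eq_square algebra_simps)
    then show ?thesis
      using that by (simp add: L2_integrable_mult)
  qed
  have "(\<lambda>\<omega>. \<Sum>t\<in>S. c t * X t \<omega>) \<in> L2 M" "(\<lambda>\<omega>. \<Sum>t\<in>S'. d t * X t \<omega>) \<in> L2 M"
    "(\<lambda>\<omega>. \<Sum>t\<in>S. c t * Y t \<omega>) \<in> L2 N" "(\<lambda>\<omega>. \<Sum>t\<in>S'. d t * Y t \<omega>) \<in> L2 N"
    using S assms(1,2) by (auto intro!: L2_lincomb)
  then show ?thesis
    using S by (simp add: expand ip)
qed

text \<open>The isometry of the algebraic spans extends to the closed spans: if combinations of the \<open>X t\<close>
  converge to \<open>\<xi>\<close>, the same combinations of the \<open>Y t\<close> form a Cauchy sequence, and \<open>\<eta>\<close> is its limit.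
  The conclusion describes \<open>\<eta>\<close> through its inner products with all of \<open>L\<^sup>2\<close>, not merely with the
  closed span: whenever \<open>\<phi>\<close> and \<open>\<psi>\<close> have the same coefficients with respect to the two families, they
  have the same inner products with the approximants, hence with \<open>\<xi>\<close> and \<open>\<eta>\<close>. Taking \<open>\<phi> = X t\<close> and
  \<open>\<psi> = Y t\<close> shows that \<open>\<xi>\<close> and \<open>\<eta>\<close> have equal coefficients.\<close>

lemma closed_span_L2_transfer:
  assumes X: "\<And>t. t \<in> T \<Longrightarrow> X t \<in> L2 M" and Y: "\<And>t. t \<in> T \<Longrightarrow> Y t \<in> L2 N"
    and gram: "\<And>s t. s \<in> T \<Longrightarrow> t \<in> T \<Longrightarrow> (\<integral>\<omega>. X s \<omega> * X t \<omega> \<partial>M) = (\<integral>\<omega>. Y s \<omega> * Y t \<omega> \<partial>N)"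
    and \<xi>: "\<xi> \<in> closed_span_L2 M T X"
  shows "\<exists>\<eta>\<in>closed_span_L2 N T Y. \<forall>\<phi>\<in>L2 M. \<forall>\<psi>\<in>L2 N.
    (\<forall>t\<in>T. (\<integral>\<omega>. \<phi> \<omega> * X t \<omega> \<partial>M) = (\<integral>\<omega>. \<psi> \<omega> * Y t \<omega> \<partial>N)) \<longrightarrow>
    (\<integral>\<omega>. \<xi> \<omega> * \<phi> \<omega> \<partial>M) = (\<integral>\<omega>. \<eta> \<omega> * \<psi> \<omega> \<partial>N)"
proof -
  obtain S c where fin: "\<And>n. finite (S n)" and S: "\<And>n. S n \<subseteq> T"
    and close: "\<And>n. (\<integral>\<omega>. (\<xi> \<omega> - (\<Sum>t\<in>S n. c n t * X t \<omega>))\<^sup>2 \<partial>M) < (1/4) ^ Suc n"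
    by (rule closed_span_L2_approx_sequence[OF \<xi>, of "\<lambda>n. (1/4) ^ Suc n"]) (simp, rule that)
  define p where "p n \<omega> = (\<Sum>t\<in>S n. c n t * X t \<omega>)" for n \<omega>
  define q where "q n \<omega> = (\<Sum>t\<in>S n. c n t * Y t \<omega>)" for n \<omega>
  have p: "p n \<in> L2 M" for n
    unfolding p_def[abs_def] by (rule L2_lincomb, rule X) (use S in blast)
  have q: "q n \<in> L2 N" for n
    unfolding q_def[abs_def] by (rule L2_lincomb, rule Y) (use S in blast)
  note \<xi>L = closed_span_L2_subset_L2[OF \<xi>]
  \<comment> \<open>Here the rate \<open>(1/4) ^ Suc n\<close> pays for the factor \<open>2\<close> on each of the two errors.\<close>
  have cauchy: "(\<integral>\<omega>. (q m \<omega> - q n \<omega>)\<^sup>2 \<partial>N) \<le> (1/4) ^ n" if "n \<le> m" for m n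
  proof -
    have "(\<integral>\<omega>. (q m \<omega> - q n \<omega>)\<^sup>2 \<partial>N) = (\<integral>\<omega>. (p m \<omega> - p n \<omega>)\<^sup>2 \<partial>M)"
      unfolding p_def q_def by (rule integral_power2_lincomb_diff[symmetric, OF X Y gram S S])
    also have "\<dots> \<le> 2 * (\<integral>\<omega>. (p m \<omega> - \<xi> \<omega>)\<^sup>2 \<partial>M) + 2 * (\<integral>\<omega>. (\<xi> \<omega> - p n \<omega>)\<^sup>2 \<partial>M)"
      by (intro integral_power2_diff_le p \<xi>L)
    also have "\<dots> \<le> 2 * (1/4) ^ Suc m + 2 * (1/4) ^ Suc n"
      using close[of m] close[of n] by (simp add: p_def power2_commute)
    also have "\<dots> \<le> (1/4) ^ n"
      using power_decreasing[OF that, of "1/4::real"] by (simp add: field_simps)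
    finally show ?thesis .
  qed
  obtain \<eta> where \<eta>: "\<eta> \<in> L2 N" and q_lim: "L2_tendsto N q \<eta>"
    by (rule L2_complete[OF q cauchy])
  have p_lim: "L2_tendsto M p \<xi>"
    unfolding L2_tendsto_def
  proof (rule tendsto_sandwich[OF _ _ tendsto_const])
    show "(\<lambda>n. (1/4::real) ^ Suc n) \<longlonglongrightarrow> 0"
      by (intro LIMSEQ_Suc LIMSEQ_power_zero) simp
    show "\<forall>\<^sub>F n in sequentially. (\<integral>\<omega>. (\<xi> \<omega> - p n \<omega>)\<^sup>2 \<partial>M) \<le> (1/4) ^ Suc n"
      using close unfolding p_def by (intro always_eventually allI less_imp_le) blast
  qed simp
  show ?thesis
  proof (intro bexI[of _ \<eta>] ballI impI)
    have q_span: "q n \<in> closed_span_L2 N T Y" for n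
      unfolding q_def[abs_def] by (rule closed_span_L2_lincomb[OF Y fin S])
    show "\<eta> \<in> closed_span_L2 N T Y"
      by (intro closed_span_L2_closed[OF _ \<eta> q_span q_lim] Y)
    fix \<phi> \<psi>
    assume \<phi>: "\<phi> \<in> L2 M" and \<psi>: "\<psi> \<in> L2 N"
      and eq: "\<forall>t\<in>T. (\<integral>\<omega>. \<phi> \<omega> * X t \<omega> \<partial>M) = (\<integral>\<omega>. \<psi> \<omega> * Y t \<omega> \<partial>N)"
    have "(\<integral>\<omega>. p n \<omega> * \<phi> \<omega> \<partial>M) = (\<integral>\<omega>. q n \<omega> * \<psi> \<omega> \<partial>N)" for n
    proof -
      have "(\<integral>\<omega>. p n \<omega> * \<phi> \<omega> \<partial>M) = (\<Sum>t\<in>S n. c n t * (\<integral>\<omega>. \<phi> \<omega> * X t \<omega> \<partial>M))"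
        unfolding p_def using S X \<phi> by (intro integral_mult_lincomb) auto
      also have "\<dots> = (\<Sum>t\<in>S n. c n t * (\<integral>\<omega>. \<psi> \<omega> * Y t \<omega> \<partial>N))"
        using S eq by (intro sum.cong) auto
      also have "\<dots> = (\<integral>\<omega>. q n \<omega> * \<psi> \<omega> \<partial>N)"
        unfolding q_def using S Y \<psi> by (intro integral_mult_lincomb[symmetric]) auto
      finally show ?thesis .
    qed
    then show "(\<integral>\<omega>. \<xi> \<omega> * \<phi> \<omega> \<partial>M) = (\<integral>\<omega>. \<eta> \<omega> * \<psi> \<omega> \<partial>N)"
      using L2_tendsto_integral_mult[OF \<xi>L p \<phi> p_lim] L2_tendsto_integral_mult[OF \<eta> q \<psi> q_lim]
      by (auto intro: LIMSEQ_unique)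
  qed
qed

text \<open>The transfer from a family to itself, with \<open>\<phi>\<close> and \<open>0\<close> as functions with equal coefficients.\<close>

lemma closed_span_L2_orthogonal:
  assumes X: "\<And>t. t \<in> T \<Longrightarrow> X t \<in> L2 M" and \<xi>: "\<xi> \<in> closed_span_L2 M T X"
    and \<phi>: "\<phi> \<in> L2 M" and orth: "\<And>t. t \<in> T \<Longrightarrow> (\<integral>\<omega>. \<phi> \<omega> * X t \<omega> \<partial>M) = 0"
  shows "(\<integral>\<omega>. \<xi> \<omega> * \<phi> \<omega> \<partial>M) = 0"
proof -
  obtain \<eta> where \<eta>: "\<forall>\<phi>\<in>L2 M. \<forall>\<psi>\<in>L2 M.
    (\<forall>t\<in>T. (\<integral>\<omega>. \<phi> \<omega> * X t \<omega> \<partial>M) = (\<integral>\<omega>. \<psi> \<omega> * X t \<omega> \<partial>M)) \<longrightarrow>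
    (\<integral>\<omega>. \<xi> \<omega> * \<phi> \<omega> \<partial>M) = (\<integral>\<omega>. \<eta> \<omega> * \<psi> \<omega> \<partial>M)"
    using closed_span_L2_transfer[OF X X refl \<xi>] ..
  have "(\<integral>\<omega>. \<xi> \<omega> * \<phi> \<omega> \<partial>M) = (\<integral>\<omega>. \<eta> \<omega> * 0 \<partial>M)"
    using orth by (intro \<eta>[rule_format] \<phi> L2_zero) simp
  then show ?thesis by simp
qed

text \<open>An element of a closed span is determined by its coefficients almost everywhere, so inner
  products in corresponding closed spans may be computed from any elements with matching
  coefficients. The proof exchanges one element for another: \<open>\<zeta>\<close>, the image of \<open>\<xi>\<close>, is replaced by \<open>\<eta>\<close> inside
  the inner product with \<open>\<eta>'\<close>, which only sees coefficients.\<close>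

lemma integral_mult_eq_if_same_coefficients:
  assumes X: "\<And>t. t \<in> T \<Longrightarrow> X t \<in> L2 M" and Y: "\<And>t. t \<in> T \<Longrightarrow> Y t \<in> L2 N"
    and gram: "\<And>s t. s \<in> T \<Longrightarrow> t \<in> T \<Longrightarrow> (\<integral>\<omega>. X s \<omega> * X t \<omega> \<partial>M) = (\<integral>\<omega>. Y s \<omega> * Y t \<omega> \<partial>N)"
    and \<xi>: "\<xi> \<in> closed_span_L2 M T X" "\<xi>' \<in> closed_span_L2 M T X"
    and \<eta>: "\<eta> \<in> closed_span_L2 N T Y" "\<eta>' \<in> closed_span_L2 N T Y"
    and eq: "\<And>t. t \<in> T \<Longrightarrow> (\<integral>\<omega>. \<xi> \<omega> * X t \<omega> \<partial>M) = (\<integral>\<omega>. \<eta> \<omega> * Y t \<omega> \<partial>N)"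
    and eq': "\<And>t. t \<in> T \<Longrightarrow> (\<integral>\<omega>. \<xi>' \<omega> * X t \<omega> \<partial>M) = (\<integral>\<omega>. \<eta>' \<omega> * Y t \<omega> \<partial>N)"
  shows "(\<integral>\<omega>. \<xi> \<omega> * \<xi>' \<omega> \<partial>M) = (\<integral>\<omega>. \<eta> \<omega> * \<eta>' \<omega> \<partial>N)"
proof -
  note L = \<xi>[THEN closed_span_L2_subset_L2] \<eta>[THEN closed_span_L2_subset_L2]
  obtain \<zeta> where \<zeta>: "\<zeta> \<in> closed_span_L2 N T Y"
    and \<zeta>_eq: "\<forall>\<phi>\<in>L2 M. \<forall>\<psi>\<in>L2 N.
      (\<forall>t\<in>T. (\<integral>\<omega>. \<phi> \<omega> * X t \<omega> \<partial>M) = (\<integral>\<omega>. \<psi> \<omega> * Y t \<omega> \<partial>N)) \<longrightarrow>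
      (\<integral>\<omega>. \<xi> \<omega> * \<phi> \<omega> \<partial>M) = (\<integral>\<omega>. \<zeta> \<omega> * \<psi> \<omega> \<partial>N)"
    using closed_span_L2_transfer[OF X Y gram \<xi>(1)] ..
  note \<zeta>L = closed_span_L2_subset_L2[OF \<zeta>]
  have \<zeta>\<eta>: "\<forall>t\<in>T. (\<integral>\<omega>. \<zeta> \<omega> * Y t \<omega> \<partial>N) = (\<integral>\<omega>. \<eta> \<omega> * Y t \<omega> \<partial>N)"
  proof
    fix t assume t: "t \<in> T"
    then have "(\<integral>\<omega>. \<xi> \<omega> * X t \<omega> \<partial>M) = (\<integral>\<omega>. \<zeta> \<omega> * Y t \<omega> \<partial>N)"
      by (intro \<zeta>_eq[rule_format] X Y gram)
    with eq[OF t] show "(\<integral>\<omega>. \<zeta> \<omega> * Y t \<omega> \<partial>N) = (\<integral>\<omega>. \<eta> \<omega> * Y t \<omega> \<partial>N)"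
      by simp
  qed
  obtain \<theta> where
    \<theta>_eq: "\<forall>\<phi>\<in>L2 N. \<forall>\<psi>\<in>L2 N.
      (\<forall>t\<in>T. (\<integral>\<omega>. \<phi> \<omega> * Y t \<omega> \<partial>N) = (\<integral>\<omega>. \<psi> \<omega> * Y t \<omega> \<partial>N)) \<longrightarrow>
      (\<integral>\<omega>. \<eta>' \<omega> * \<phi> \<omega> \<partial>N) = (\<integral>\<omega>. \<theta> \<omega> * \<psi> \<omega> \<partial>N)"
    using closed_span_L2_transfer[OF Y Y refl \<eta>(2)] ..
  have "(\<integral>\<omega>. \<xi> \<omega> * \<xi>' \<omega> \<partial>M) = (\<integral>\<omega>. \<zeta> \<omega> * \<eta>' \<omega> \<partial>N)"
    by (intro \<zeta>_eq[rule_format] L eq')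
  also have "\<dots> = (\<integral>\<omega>. \<theta> \<omega> * \<eta> \<omega> \<partial>N)"
    using \<theta>_eq[rule_format, OF \<zeta>L L(3) \<zeta>\<eta>[rule_format]] by (simp add: mult.commute)
  also have "\<dots> = (\<integral>\<omega>. \<eta> \<omega> * \<eta>' \<omega> \<partial>N)"
    using \<theta>_eq L(3) by (simp add: mult.commute)
  finally show ?thesis .
qed

section \<open>Step functions are dense\<close>

lemma L2_tendsto_dominated:
  assumes f: "f \<in> borel_measurable M" and q: "\<And>n. q n \<in> borel_measurable M"
    and conv: "AE x in M. (\<lambda>n. q n x) \<longlonglongrightarrow> f x"
    and g: "integrable M g" and dom: "\<And>n. AE x in M. (f x - q n x)\<^sup>2 \<le> g x"
  shows "L2_tendsto M q f"
proof -
  have "(\<lambda>n. \<integral>x. (f x - q n x)\<^sup>2 \<partial>M) \<longlonglongrightarrow> (\<integral>x. 0 \<partial>M)"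
  proof (rule integral_dominated_convergence[OF _ _ g])
    show "AE x in M. (\<lambda>n. (f x - q n x)\<^sup>2) \<longlonglongrightarrow> 0"
      using conv
    proof eventually_elim
      case (elim x)
      have "(\<lambda>n. (f x - q n x)\<^sup>2) \<longlonglongrightarrow> (f x - f x)\<^sup>2"
        by (intro tendsto_intros elim)
      then show ?case by simp
    qed
  qed (use f q dom in auto)
  then show ?thesis by (simp add: L2_tendsto_def)
qed

context
  fixes N :: "real measure"
  assumes sets_N [measurable_cong, simp]: "sets N = sets borel" and fin: "emeasure N {0<..1} < \<infinity>"
begin

lemma space_N: "space N = UNIV"
  using sets_eq_imp_space_eq[OF sets_N] by simp

lemma indicator_in_L2:
  assumes "A \<in> sets borel" "A \<subseteq> {0<..1}"
  shows "indicator A \<in> L2 N"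
proof -
  have "emeasure N A < \<infinity>"
    using emeasure_mono[OF assms(2), of N] fin by (auto intro: le_less_trans)
  then have "integrable N (indicator A :: real \<Rightarrow> real)"
    using assms by (simp add: integrable_indicator_iff)
  moreover have "(indicator A x :: real)\<^sup>2 = indicator A x" for x
    by (simp add: indicator_def)
  ultimately show ?thesis
    using assms by (auto simp: L2_def)
qed

abbreviation "step_span \<equiv> closed_span_L2 N {0..1} (\<lambda>t::real. indicator {0<..t})"

lemma step_in_L2: "t \<in> {0..1} \<Longrightarrow> indicator {0<..t} \<in> L2 N"
  by (intro indicator_in_L2) auto

lemma step_in_step_span: "t \<in> {0..1} \<Longrightarrow> indicator {0<..t} \<in> step_span"
  using closed_span_L2_lincomb[of "{0..1}" "\<lambda>t::real. indicator {0<..t}" N "{t}" "\<lambda>_. 1"] step_in_L2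
  by auto

lemma step_span_zero: "(\<lambda>x. 0) \<in> step_span"
  by (rule closed_span_L2_zero[OF step_in_L2])

text \<open>The sets whose trace on \<open>(0,1]\<close> has its indicator in the closed span form a Dynkin system, by
  linearity and dominated convergence, and this system contains the half-lines \<open>(-\<infinity>,a]\<close>, which
  generate the Borel sets.\<close>

lemma indicator_in_step_span:
  assumes "A \<in> sets borel"
  shows "(\<lambda>x. indicator (A \<inter> {0<..1}) x) \<in> step_span"
proof -
  let ?I = "{0<..1::real}"
  have "Int_stable (range (\<lambda>a::real. {..a}))"
    by (auto simp: Int_stable_def)
  moreover have "range (\<lambda>a::real. {..a}) \<subseteq> Pow UNIV"
    by simp
  moreover have "A \<in> sigma_sets UNIV (range (\<lambda>a::real. {..a}))"
    using assms unfolding borel_eq_atMost by simp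
  ultimately show ?thesis
  proof (induction rule: sigma_sets_induct_disjoint)
    case (basic A)
    then obtain a where "A = {..a}" by auto
    \<comment> \<open>Clamping \<open>a\<close> to \<open>[0,1]\<close> keeps the step indexed by \<open>[0,1]\<close>; for \<open>a \<le> 0\<close> it is empty.\<close>
    then have "A \<inter> ?I = {0<..max 0 (min a 1)}" by auto
    then show ?case using step_in_step_span[of "max 0 (min a 1)"] by simp
  next
    case empty
    show ?case using step_span_zero by simp
  next
    case (compl A)
    have "(\<lambda>x. indicator {0<..1} x + (-1) * indicator (A \<inter> ?I) x) \<in> step_span"
      by (intro closed_span_L2_add closed_span_L2_cmult step_in_step_span step_in_L2 compl.IH) auto
    moreover have "indicator ((UNIV - A) \<inter> ?I) x = indicator {0<..1} x + (-1) * (indicator (A \<inter> ?I) x :: real)" for x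
      by (auto simp: indicator_def)
    ultimately show ?case by simp
  next
    case (union A)
    have meas: "A i \<in> sets borel" for i
      using union(2) unfolding borel_eq_atMost by auto
    define q where "q n x = (\<Sum>i<n. indicator (A i \<inter> ?I) x :: real)" for n :: nat and x
    have q_eq: "q n x = indicator ((\<Union>i<n. A i) \<inter> ?I) x" for n x
    proof -
      have "disjoint_family_on (\<lambda>i. A i \<inter> ?I) {..<n}"
        using union(1) by (fastforce simp: disjoint_family_on_def)
      then have "indicator (\<Union>i\<in>{..<n}. A i \<inter> ?I) x = q n x"
        unfolding q_def by (intro indicator_UN_disjoint) auto
      then show ?thesis by simp
    qed
    have q_span: "q n \<in> step_span" for n
    proof (induction n)
      case 0
      show ?case using step_span_zero by (simp add: q_def[abs_def])
    next
      case (Suc n)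
      have "(\<lambda>x. q n x + indicator (A n \<inter> ?I) x) \<in> step_span"
        by (intro closed_span_L2_add step_in_L2 Suc union.IH)
      then show ?case by (simp add: q_def[abs_def])
    qed
    have "L2_tendsto N q (indicator ((\<Union>i. A i) \<inter> ?I))"
    proof (rule L2_tendsto_dominated)
      show "q n \<in> borel_measurable N" for n
        using closed_span_L2_subset_L2[OF q_span] by (simp add: L2_def)
      show "indicator ((\<Union>i. A i) \<inter> ?I) \<in> borel_measurable N"
        using meas by simp
      show "integrable N (indicator ?I :: real \<Rightarrow> real)"
        by (rule integrable_real_indicator) (use fin in simp_all)
      show "AE x in N. (indicator ((\<Union>i. A i) \<inter> ?I) x - q n x)\<^sup>2 \<le> indicator ?I x" for n
        unfolding q_eq by (auto simp: indicator_def)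
      show "AE x in N. (\<lambda>n. q n x) \<longlonglongrightarrow> indicator ((\<Union>i. A i) \<inter> ?I) x"
      proof (rule AE_I2)
        fix x
        have "(\<lambda>n. indicator (\<Union>i<n. A i) x * indicator ?I x :: real)
            \<longlonglongrightarrow> indicator (\<Union>i. A i) x * indicator ?I x"
          by (intro tendsto_intros LIMSEQ_indicator_UN)
        then show "(\<lambda>n. q n x) \<longlonglongrightarrow> indicator ((\<Union>i. A i) \<inter> ?I) x"
          unfolding q_eq by (simp add: indicator_inter_arith)
      qed
    qed
    moreover have "indicator ((\<Union>i. A i) \<inter> ?I) \<in> L2 N"
      using meas by (intro indicator_in_L2) auto
    ultimately have "indicator ((\<Union>i. A i) \<inter> ?I) \<in> step_span"
      by (intro closed_span_L2_closed[OF step_in_L2 _ q_span])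
    then show ?case by simp
  qed
qed

text \<open>A function is the dominated limit of simple functions, and simple functions are combinations of
  indicators.\<close>

lemma L2_in_step_span:
  assumes f: "f \<in> L2 N" and supp: "\<And>x. x \<notin> {0<..1} \<Longrightarrow> f x = 0"
  shows "f \<in> step_span"
proof -
  note [simp] = space_N
  have f_meas: "f \<in> borel_measurable N"
    using f by (simp add: L2_def)
  obtain s where s: "\<And>i. simple_function N (s i)" and s_lim: "\<And>x. (\<lambda>i. s i x) \<longlonglongrightarrow> f x"
    and s_bound: "\<And>i x. dist (s i x) 0 \<le> 2 * dist (f x) 0"
    using borel_measurable_implies_sequence_metric[OF f_meas, of 0] by auto
  have s_supp: "s i x = 0" if "x \<notin> {0<..1}" for i x
    using s_bound[of i x] supp[OF that] by simp
  have s_span: "s i \<in> step_span" for i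
  proof -
    have sum_span: "(\<lambda>x. \<Sum>y\<in>Y. y * indicator ((s i -` {y}) \<inter> {0<..1}) x) \<in> step_span" if "finite Y" for Y
      using that
    proof induction
      case empty
      show ?case using step_span_zero by simp
    next
      case (insert y Y)
      have "s i -` {y} \<in> sets borel"
        using simple_functionD(2)[OF s[of i], of "{y}"] by simp
      then have "(\<lambda>x. y * indicator ((s i -` {y}) \<inter> {0<..1}) x
          + (\<Sum>y\<in>Y. y * indicator ((s i -` {y}) \<inter> {0<..1}) x)) \<in> step_span"
        by (intro closed_span_L2_add closed_span_L2_cmult step_in_L2 indicator_in_step_span insert.IH)
      then show ?case
        unfolding sum.insert[OF insert.hyps] .
    qed
    have finite: "finite (range (s i))"
      using simple_functionD(1)[OF s[of i]] by simp
    have "s i x = (\<Sum>y\<in>range (s i). y * indicator ((s i -` {y}) \<inter> {0<..1}) x)" for x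
    proof -
      have "(\<Sum>y\<in>range (s i). y * indicator ((s i -` {y}) \<inter> {0<..1}) x)
          = (\<Sum>y\<in>{s i x}. y * indicator ((s i -` {y}) \<inter> {0<..1}) x)"
        by (rule sum.mono_neutral_right[OF finite]) auto
      also have "\<dots> = s i x"
        using s_supp[of x i] by (auto simp: indicator_def)
      finally show ?thesis by simp
    qed
    then have "s i = (\<lambda>x. \<Sum>y\<in>range (s i). y * indicator ((s i -` {y}) \<inter> {0<..1}) x)"
      by (rule ext)
    then show ?thesis
      using sum_span[OF finite] by simp
  qed
  have "L2_tendsto N s f"
  proof (rule L2_tendsto_dominated[OF f_meas])
    show "s i \<in> borel_measurable N" for i
      by (rule borel_measurable_simple_function[OF s])
    show "AE x in N. (\<lambda>n. s n x) \<longlonglongrightarrow> f x"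
      using s_lim by simp
    show "integrable N (\<lambda>x. 9 * (f x)\<^sup>2)"
      using L2_integrable_power2[OF f] by simp
    \<comment> \<open>Since \<open>\<bar>s i x\<bar> \<le> 2 \<bar>f x\<bar>\<close>, the distance to \<open>f x\<close> is at most \<open>3 \<bar>f x\<bar>\<close>.\<close>
    have "(f x - s i x)\<^sup>2 \<le> 9 * (f x)\<^sup>2" for i x
    proof -
      have "\<bar>f x - s i x\<bar> \<le> \<bar>3 * f x\<bar>"
        using s_bound[of i x] by (simp add: abs_mult)
      then show ?thesis
        by (simp add: abs_le_square_iff power_mult_distrib)
    qed
    then show "AE x in N. (f x - s i x)\<^sup>2 \<le> 9 * (f x)\<^sup>2" for i
      by simp
  qed
  then show ?thesis
    by (intro closed_span_L2_closed[OF step_in_L2 f s_span])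
qed

end

section \<open>Indefinite integrals are cadlag\<close>

text \<open>One-sided limits of \<open>y \<mapsto> \<integral>\<^bsub>(0,y]\<^esub> G dN\<close> reduce, by dominated convergence along sequences, to
  pointwise limits of the indicators of \<open>(0,y]\<close>: these are the indicator of \<open>(0,x]\<close> from the right and
  that of \<open>(0,x)\<close> from the left, so atoms of the measure produce jumps.\<close>

lemma tendsto_indefinite_integral:
  fixes G :: "real \<Rightarrow> real"
  assumes G: "integrable N G" and N [measurable_cong, simp]: "sets N = sets borel"
    and A [measurable]: "A \<in> sets borel"
    and conv: "\<And>X s. (\<forall>i. X i \<in> T) \<Longrightarrow> X \<longlonglongrightarrow> x \<Longrightarrow> (\<lambda>i::nat. indicator {0<..X i} s :: real) \<longlonglongrightarrow> indicator A s"
  shows "((\<lambda>y. \<integral>s. indicator {0<..y} s * G s \<partial>N) \<longlongrightarrow> (\<integral>s. indicator A s * G s \<partial>N)) (at x within T)"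
  unfolding tendsto_at_iff_sequentially comp_def
proof (intro allI impI)
  have [measurable]: "G \<in> borel_measurable N"
    using G by simp
  fix X :: "nat \<Rightarrow> real"
  assume X: "\<forall>i. X i \<in> T - {x}" "X \<longlonglongrightarrow> x"
  show "(\<lambda>i. \<integral>s. indicator {0<..X i} s * G s \<partial>N) \<longlonglongrightarrow> (\<integral>s. indicator A s * G s \<partial>N)"
  proof (rule integral_dominated_convergence)
    show "integrable N (\<lambda>s. norm (G s))"
      using G by simp
    show "AE s in N. (\<lambda>i. indicator {0<..X i} s * G s) \<longlonglongrightarrow> indicator A s * G s"
      using conv[of X] X by (intro AE_I2 tendsto_intros) auto
    show "AE s in N. norm (indicator {0<..X i} s * G s) \<le> norm (G s)" for i
      by (auto simp: indicator_def)
  qed (use A in measurable)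
qed

lemma tendsto_indefinite_integral_right:
  fixes G :: "real \<Rightarrow> real"
  assumes "integrable N G" and "sets N = sets borel"
  shows "((\<lambda>y. \<integral>s. indicator {0<..y} s * G s \<partial>N) \<longlongrightarrow> (\<integral>s. indicator {0<..x} s * G s \<partial>N)) (at x within {x<..})"
proof (rule tendsto_indefinite_integral[OF assms])
  fix X :: "nat \<Rightarrow> real" and s
  assume X: "\<forall>i. X i \<in> {x<..}" "X \<longlonglongrightarrow> x"
  show "(\<lambda>i. indicator {0<..X i} s :: real) \<longlonglongrightarrow> indicator {0<..x} s"
  proof (cases "s \<le> x")
    case True
    have "indicator {0<..X i} s = (indicator {0<..x} s :: real)" for i
      using True X(1)[rule_format, of i] by (simp add: indicator_def)
    then show ?thesis by simp
  next
    case False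
    then have "\<forall>\<^sub>F i in sequentially. X i < s"
      using X(2) by (intro order_tendstoD) auto
    then show ?thesis
      by (rule tendsto_eventually[OF eventually_mono]) (use False in \<open>auto simp: indicator_def\<close>)
  qed
qed simp

lemma tendsto_indefinite_integral_left:
  fixes G :: "real \<Rightarrow> real"
  assumes "integrable N G" and "sets N = sets borel"
  shows "((\<lambda>y. \<integral>s. indicator {0<..y} s * G s \<partial>N) \<longlongrightarrow> (\<integral>s. indicator {0<..<x} s * G s \<partial>N)) (at x within {..<x})"
proof (rule tendsto_indefinite_integral[OF assms])
  fix X :: "nat \<Rightarrow> real" and s
  assume X: "\<forall>i. X i \<in> {..<x}" "X \<longlonglongrightarrow> x"
  show "(\<lambda>i. indicator {0<..X i} s :: real) \<longlonglongrightarrow> indicator {0<..<x} s"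
  proof (cases "s < x")
    case True
    then have "\<forall>\<^sub>F i in sequentially. s < X i"
      using X(2) by (intro order_tendstoD) auto
    then show ?thesis
      by (rule tendsto_eventually[OF eventually_mono]) (use True in \<open>auto simp: indicator_def\<close>)
  next
    case False
    have "indicator {0<..X i} s = (indicator {0<..<x} s :: real)" for i
      using False X(1)[rule_format, of i] by (simp add: indicator_def)
    then show ?thesis by simp
  qed
qed simp

lemma cadlag_on_indefinite_integral:
  fixes G :: "real \<Rightarrow> real"
  assumes G: "integrable N G" "sets N = sets borel"
    and f: "\<And>x. x \<in> S \<Longrightarrow> f x = (\<integral>s. indicator {0<..x} s * G s \<partial>N)"
  shows "cadlag_on S f"
  unfolding cadlag_on_def
proof (intro ballI conjI exI)
  let ?g = "\<lambda>y. \<integral>s. indicator {0<..y} s * G s \<partial>N"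
  have cong: "(f \<longlongrightarrow> l) (at x within S \<inter> T)" if "(?g \<longlongrightarrow> l) (at x within T)" for T l x
  proof (rule Lim_transform_eventually)
    show "(?g \<longlongrightarrow> l) (at x within S \<inter> T)"
      using that by (rule tendsto_within_subset) auto
    show "\<forall>\<^sub>F y in at x within S \<inter> T. ?g y = f y"
      using f by (auto simp: eventually_at_filter)
  qed
  fix x assume "x \<in> S"
  then show "(f \<longlongrightarrow> f x) (at x within S \<inter> {x<..})"
    using tendsto_indefinite_integral_right[OF G] f by (intro cong) simp
  show "(f \<longlongrightarrow> (\<integral>s. indicator {0<..<x} s * G s \<partial>N)) (at x within S \<inter> {..<x})"
    using tendsto_indefinite_integral_left[OF G] by (intro cong)
qed

section \<open>The bridge functions\<close>

text \<open>The orthogonal projection of the step \<open>1\<^bsub>(0,t]\<^esub>\<close> onto the functions of mean zero in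
  \<open>L\<^sup>2((0,1], dW)\<close>. The constant function is cut off to \<open>(0,1]\<close>, so that everything can be
  integrated over the whole line.\<close>

definition bridge_fun :: "(real \<Rightarrow> real) \<Rightarrow> real \<Rightarrow> real \<Rightarrow> real" where
  "bridge_fun W t x = indicator {0<..t} x - W t / W 1 * indicator {0<..1} x"

context
  fixes W :: "real \<Rightarrow> real"
  assumes strict_mono_W: "strict_mono W" and cadlag_W: "cadlag_on UNIV W"
    and cont_W_0: "isCont W 0" and W_0: "W 0 = 0"
begin

lemma W_1_pos: "0 < W 1"
  using strict_monoD[OF strict_mono_W, of 0 1] W_0 by simp

lemma emeasure_dW_Ioc: "a \<le> b \<Longrightarrow> emeasure (interval_measure W) {a<..b} = W b - W a"
  using strict_mono_W cadlag_W
  by (intro emeasure_interval_measure_Ioc)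
    (auto simp: strict_mono_less_eq continuous_within cadlag_on_def)

lemma emeasure_dW_unit: "emeasure (interval_measure W) {0<..1} < \<infinity>"
  by (simp add: emeasure_dW_Ioc)

lemma integral_step: "0 \<le> t \<Longrightarrow> (\<integral>s. indicator {0<..t} s \<partial>interval_measure W) = W t"
  using emeasure_dW_Ioc[of 0 t] strict_mono_less_eq[OF strict_mono_W, of 0 t] W_0
  by (simp add: measure_def)

text \<open>The only atom that matters is the one at \<open>0\<close>, which would separate \<open>[0,1]\<close> from \<open>(0,1]\<close>;
  continuity of \<open>W\<close> at \<open>0\<close> excludes it.\<close>

lemma emeasure_dW_0: "emeasure (interval_measure W) {0} = 0"
proof -
  have "(\<lambda>n. ennreal (W 0 - W (- inverse (real (Suc n))))) \<longlonglongrightarrow> ennreal (W 0 - W 0)"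
    using LIMSEQ_inverse_real_of_nat_add_minus[of 0]
    by (intro tendsto_intros isCont_tendsto_compose[OF cont_W_0]) simp
  moreover have "emeasure (interval_measure W) {0} \<le> ennreal (W 0 - W (- inverse (real (Suc n))))" for n
  proof -
    have "emeasure (interval_measure W) {0} \<le> emeasure (interval_measure W) {- inverse (real (Suc n))<..0}"
      by (intro emeasure_mono) auto
    then show ?thesis
      by (simp add: emeasure_dW_Ioc)
  qed
  ultimately have "emeasure (interval_measure W) {0} \<le> ennreal (W 0 - W 0)"
    by (intro LIMSEQ_le_const) auto
  then show ?thesis by simp
qed

lemma AE_indicator_unit: "AE s in interval_measure W. indicator {0..1} s = (indicator {0<..1} s :: real)"
proof (rule AE_I')
  show "{0} \<in> null_sets (interval_measure W)"
    using emeasure_dW_0 by (simp add: null_sets_def)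
qed (auto simp: indicator_def)

lemma step_in_L2_dW: "t \<in> {0..1} \<Longrightarrow> indicator {0<..t} \<in> L2 (interval_measure W)"
  by (rule step_in_L2[OF sets_interval_measure emeasure_dW_unit])

lemma bridge_fun_in_L2:
  assumes "t \<in> {0..1}"
  shows "bridge_fun W t \<in> L2 (interval_measure W)"
  unfolding bridge_fun_def[abs_def]
  by (intro L2_diff L2_cmult step_in_L2_dW assms) simp

lemma integral_mult_step_step:
  assumes "s \<in> {0..1}" "t \<in> {0..1}"
  shows "(\<integral>x. indicator {0<..s} x * indicator {0<..t} x \<partial>interval_measure W) = W (min s t)"
proof -
  have "indicator {0<..s} x * indicator {0<..t} x = (indicator {0<..min s t} x :: real)" for x
    by (simp add: indicator_def)
  then show ?thesis
    using integral_step[of "min s t"] assms by simp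
qed

lemma integral_mult_step_bridge_fun:
  assumes "s \<in> {0..1}" "t \<in> {0..1}"
  shows "(\<integral>x. indicator {0<..t} x * bridge_fun W s x \<partial>interval_measure W) = rho_W0 W s t"
proof -
  have 1: "(1::real) \<in> {0..1}" by simp
  note int = L2_integrable_mult[OF step_in_L2_dW step_in_L2_dW]
  have "(\<integral>x. indicator {0<..t} x * bridge_fun W s x \<partial>interval_measure W)
      = (\<integral>x. indicator {0<..t} x * indicator {0<..s} x
          - W s / W 1 * (indicator {0<..t} x * indicator {0<..1} x) \<partial>interval_measure W)"
    by (simp add: bridge_fun_def algebra_simps)
  also have "\<dots> = W (min t s) - W s / W 1 * W (min t 1)"
    using int[OF assms(2) assms(1)] int[OF assms(2) 1] assms
    by (simp add: integral_mult_step_step del: Bochner_Integration.integral_mult_right_zero)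
  finally show ?thesis
    using assms by (simp add: rho_W0_def min.commute)
qed

text \<open>Against a function of mean zero, the bridge function acts like the uncentered step. This is why
  the coefficients of \<open>G\<close> are the values of its indefinite integral.\<close>

lemma integral_mult_bridge_fun:
  assumes G: "G \<in> L2 (interval_measure W)"
    and mean: "(\<integral>s. indicator {0<..1} s * G s \<partial>interval_measure W) = 0" and t: "t \<in> {0..1}"
  shows "(\<integral>s. G s * bridge_fun W t s \<partial>interval_measure W) = (\<integral>s. indicator {0<..t} s * G s \<partial>interval_measure W)"
proof -
  have 1: "(1::real) \<in> {0..1}" by simp
  have "(\<integral>s. G s * bridge_fun W t s \<partial>interval_measure W)
      = (\<integral>s. indicator {0<..t} s * G s - W t / W 1 * (indicator {0<..1} s * G s) \<partial>interval_measure W)"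
    by (simp add: bridge_fun_def algebra_simps)
  also have "\<dots> = (\<integral>s. indicator {0<..t} s * G s \<partial>interval_measure W)"
    using L2_integrable_mult[OF step_in_L2_dW[OF t] G] L2_integrable_mult[OF step_in_L2_dW[OF 1] G] mean
    by simp
  finally show ?thesis .
qed

text \<open>The bridge function is itself of mean zero because \<^term>\<open>rho_W0 W s 1 = 0\<close>: the bridge is tied
  down at \<open>1\<close>.\<close>

lemma gram_bridge_fun:
  assumes "s \<in> {0..1}" "t \<in> {0..1}"
  shows "(\<integral>x. bridge_fun W s x * bridge_fun W t x \<partial>interval_measure W) = rho_W0 W s t"
proof -
  have "rho_W0 W s 1 = 0"
    using assms W_1_pos by (simp add: rho_W0_def)
  then have "(\<integral>x. indicator {0<..1} x * bridge_fun W s x \<partial>interval_measure W) = 0"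
    using assms by (subst integral_mult_step_bridge_fun) auto
  then show ?thesis
    using integral_mult_bridge_fun[OF bridge_fun_in_L2] integral_mult_step_bridge_fun assms by simp
qed

abbreviation "bridge_span \<equiv> closed_span_L2 (interval_measure W) {0..1} (bridge_fun W)"

lemma bridge_span_mean_zero:
  assumes "\<xi> \<in> bridge_span"
  shows "(\<integral>s. indicator {0<..1} s * \<xi> s \<partial>interval_measure W) = 0"
proof -
  have 1: "(1::real) \<in> {0..1}" by simp
  have "(\<integral>s. \<xi> s * indicator {0<..1} s \<partial>interval_measure W) = 0"
  proof (rule closed_span_L2_orthogonal[OF bridge_fun_in_L2 assms step_in_L2_dW[OF 1]])
    fix t :: real assume "t \<in> {0..1}"
    then show "(\<integral>s. indicator {0<..1} s * bridge_fun W t s \<partial>interval_measure W) = 0"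
      using integral_mult_step_bridge_fun[OF _ 1] W_1_pos by (simp add: rho_W0_def)
  qed
  then show ?thesis by (simp add: mult.commute)
qed

text \<open>The bridge functions span the mean-zero functions because the steps span everything: if \<open>p\<close> is a
  step function close to \<open>G\<close>, then subtracting from \<open>p\<close> its mean \<open>m\<close> gives a combination of bridge
  functions, and since \<open>G\<close> has mean zero this does not increase the distance:
  \<open>\<parallel>G - (p - m)\<parallel>\<^sup>2 = \<parallel>G - p\<parallel>\<^sup>2 - m\<^sup>2 W(1)\<close>.\<close>

lemma in_bridge_span:
  assumes G: "G \<in> L2 (interval_measure W)" and supp: "\<And>x. x \<notin> {0<..1} \<Longrightarrow> G x = 0"
    and mean: "(\<integral>s. G s \<partial>interval_measure W) = 0"
  shows "G \<in> bridge_span"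
proof (rule closed_span_L2I[OF G])
  let ?N = "interval_measure W" and ?I = "indicator {0<..1} :: real \<Rightarrow> real"
  have 1: "(1::real) \<in> {0..1}" by simp
  fix e :: real assume "0 < e"
  have "G \<in> closed_span_L2 ?N {0..1} (\<lambda>t. indicator {0<..t})"
    by (rule L2_in_step_span[OF sets_interval_measure emeasure_dW_unit G supp])
  then obtain S c where S: "finite S" "S \<subseteq> {0..1}"
    and close: "(\<integral>x. (G x - (\<Sum>t\<in>S. c t * indicator {0<..t} x))\<^sup>2 \<partial>?N) < e"
    using \<open>0 < e\<close> by (rule closed_span_L2_approx)
  define p where "p x = (\<Sum>t\<in>S. c t * indicator {0<..t} x)" for x :: real
  define m where "m = (\<Sum>t\<in>S. c t * W t) / W 1"
  have p: "p \<in> L2 ?N"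
    unfolding p_def[abs_def] by (rule L2_lincomb, rule step_in_L2_dW) (use S in blast)
  note I = step_in_L2_dW[OF 1] and d = L2_diff[OF G p]
  have G_I: "G x * ?I x = G x" and p_I: "p x * ?I x = p x" for x
    using supp[of x] S by (auto simp: indicator_def p_def intro!: sum.neutral)
  have int_I: "(\<integral>x. ?I x * ?I x \<partial>?N) = W 1"
    using integral_mult_step_step[OF 1 1] by simp
  have int_p: "(\<integral>x. p x * ?I x \<partial>?N) = m * W 1"
  proof -
    have "(\<integral>x. p x * ?I x \<partial>?N) = (\<Sum>t\<in>S. c t * (\<integral>x. ?I x * indicator {0<..t} x \<partial>?N))"
      unfolding p_def using S by (intro integral_mult_lincomb I step_in_L2_dW) auto
    also have "\<dots> = (\<Sum>t\<in>S. c t * W t)"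
      using S integral_mult_step_step[OF 1] by (intro sum.cong) auto
    finally show ?thesis
      using W_1_pos by (simp add: m_def)
  qed
  have lincomb: "(\<Sum>t\<in>S. c t * bridge_fun W t x) = p x - m * ?I x" for x
    by (simp add: bridge_fun_def p_def m_def right_diff_distrib sum_subtractf sum_divide_distrib
        sum_distrib_right mult.assoc)
  have "(\<integral>x. (G x - (\<Sum>t\<in>S. c t * bridge_fun W t x))\<^sup>2 \<partial>?N)
      = (\<integral>x. (G x - p x)\<^sup>2 + 2 * m * (G x - p x * ?I x) + m\<^sup>2 * (?I x * ?I x) \<partial>?N)"
  proof (rule Bochner_Integration.integral_cong[OF refl])
    fix x
    have "(G x - (\<Sum>t\<in>S. c t * bridge_fun W t x))\<^sup>2
        = (G x - p x)\<^sup>2 + 2 * m * (G x * ?I x - p x * ?I x) + m\<^sup>2 * (?I x * ?I x)"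
      unfolding lincomb by (simp add: power2_eq_square algebra_simps)
    then show "(G x - (\<Sum>t\<in>S. c t * bridge_fun W t x))\<^sup>2
        = (G x - p x)\<^sup>2 + 2 * m * (G x - p x * ?I x) + m\<^sup>2 * (?I x * ?I x)"
      by (simp add: G_I)
  qed
  also have "\<dots> = (\<integral>x. (G x - p x)\<^sup>2 \<partial>?N) + 2 * m * ((\<integral>x. G x \<partial>?N) - (\<integral>x. p x * ?I x \<partial>?N))
      + m\<^sup>2 * (\<integral>x. ?I x * ?I x \<partial>?N)"
  proof -
    have "integrable ?N G"
      using L2_integrable_mult[OF G I] by (simp add: G_I)
    then show ?thesis
      using L2_integrable_power2[OF d] L2_integrable_mult[OF p I] L2_integrable_mult[OF I I]
      by (simp add: right_diff_distrib)
  qed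
  also have "\<dots> = (\<integral>x. (G x - p x)\<^sup>2 \<partial>?N) - m\<^sup>2 * W 1"
    unfolding mean int_p int_I by (simp add: power2_eq_square)
  also have "\<dots> < e"
    using close W_1_pos unfolding p_def by (simp add: add_strict_increasing2 less_le_trans diff_less_eq)
  finally show "\<exists>S c. finite S \<and> S \<subseteq> {0..1} \<and> (\<integral>x. (G x - (\<Sum>t\<in>S. c t * bridge_fun W t x))\<^sup>2 \<partial>?N) < e"
    using S by (intro exI[of _ S] exI[of _ c]) simp
qed

section \<open>The space of W-derivatives\<close>

text \<open>Measurability of \<open>F\<close> is only known on \<open>[0,1]\<close>, and nothing constrains its values elsewhere, so
  \<open>F\<close> is replaced by its restriction to \<open>(0,1]\<close>; the point \<open>0\<close> is lost without effect on integrals.\<close>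

lemma L2_W0_restrict:
  assumes F: "F \<in> L2_W0 W"
  shows "(\<lambda>s. indicator {0<..1} s * F s) \<in> L2 (interval_measure W)"
    and "(\<integral>s. indicator {0<..1} s * F s \<partial>interval_measure W) = 0"
proof -
  let ?N = "interval_measure W"
  have meas: "(\<lambda>s. indicator {0..1} s * F s) \<in> borel_measurable ?N"
    using F by (simp add: L2_W0_def set_borel_measurable_def)
  have "(\<lambda>s. indicator {0<..1} s * (indicator {0..1} s * F s)) \<in> borel_measurable ?N"
    by (intro borel_measurable_times meas) simp
  moreover have eq: "indicator {0<..1} s * (indicator {0..1} s * F s) = indicator {0<..1} s * F s" for s
    by (simp add: indicator_def)
  ultimately have meas': "(\<lambda>s. indicator {0<..1} s * F s) \<in> borel_measurable ?N"
    by simp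
  have "integrable ?N (\<lambda>s. indicator {0..1} s * (F s)\<^sup>2)"
    using F by (simp add: L2_W0_def set_integrable_def)
  then have "integrable ?N (\<lambda>s. (indicator {0<..1} s * F s)\<^sup>2)"
    by (rule Bochner_Integration.integrable_bound)
      (use meas' in \<open>auto simp: indicator_def\<close>)
  with meas' show "(\<lambda>s. indicator {0<..1} s * F s) \<in> L2 ?N"
    by (simp add: L2_def)
  have "(\<integral>s. indicator {0<..1} s * F s \<partial>?N) = (\<integral>s. indicator {0..1} s * F s \<partial>?N)"
    using AE_indicator_unit by (intro integral_cong_AE meas meas') auto
  also have "\<dots> = 0"
    using F by (simp add: L2_W0_def set_lebesgue_integral_def)
  finally show "(\<integral>s. indicator {0<..1} s * F s \<partial>?N) = 0" .
qed

lemma W_derivative_in_bridge_span: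
  assumes D: "is_W_derivative W f F"
  shows "(\<lambda>s. indicator {0<..1} s * F s) \<in> bridge_span"
    and "\<And>t. t \<in> {0..1} \<Longrightarrow> (\<integral>s. indicator {0<..1} s * F s * bridge_fun W t s \<partial>interval_measure W) = f t"
proof -
  have F: "F \<in> L2_W0 W"
    using D by (simp add: is_W_derivative_def)
  note F0 = L2_W0_restrict[OF F]
  show "(\<lambda>s. indicator {0<..1} s * F s) \<in> bridge_span"
    by (rule in_bridge_span) (use F0 in auto)
  fix t :: real assume t: "t \<in> {0..1}"
  have "(\<integral>s. indicator {0<..1} s * F s * bridge_fun W t s \<partial>interval_measure W)
      = (\<integral>s. indicator {0<..t} s * (indicator {0<..1} s * F s) \<partial>interval_measure W)"
    using F0 by (intro integral_mult_bridge_fun t) (simp_all add: mult.assoc[symmetric] indicator_inter_arith[symmetric])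
  also have "\<dots> = (\<integral>s. indicator {0<..t} s * F s \<partial>interval_measure W)"
    using t by (intro Bochner_Integration.integral_cong) (auto simp: indicator_def)
  also have "\<dots> = f t"
    using D t by (simp add: is_W_derivative_def set_lebesgue_integral_def)
  finally show "(\<integral>s. indicator {0<..1} s * F s * bridge_fun W t s \<partial>interval_measure W) = f t" .
qed

text \<open>The coefficient function of \<open>\<eta>\<close> is its indefinite integral, which is cadlag, and vanishes at \<open>1\<close>
  because \<open>\<eta>\<close> has mean zero.\<close>

lemma in_H_WD_if_bridge_span:
  assumes \<eta>: "\<eta> \<in> bridge_span" and f: "f \<in> extensional {0..1}"
    and f_eq: "\<And>t. t \<in> {0..1} \<Longrightarrow> f t = (\<integral>s. \<eta> s * bridge_fun W t s \<partial>interval_measure W)"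
  shows "f \<in> H_WD W"
proof -
  let ?N = "interval_measure W" and ?I = "indicator {0<..1} :: real \<Rightarrow> real"
  have 1: "(1::real) \<in> {0..1}" by simp
  note L = closed_span_L2_subset_L2[OF \<eta>] and mean = bridge_span_mean_zero[OF \<eta>]
  have meas [measurable]: "\<eta> \<in> borel_measurable ?N"
    using L by (simp add: L2_def)
  have f_int: "f t = (\<integral>s. indicator {0<..t} s * \<eta> s \<partial>?N)" if "t \<in> {0..1}" for t
    using f_eq[OF that] integral_mult_bridge_fun[OF L mean that] by simp
  have "(\<integral>s. indicator {0..1} s * \<eta> s \<partial>?N) = (\<integral>s. ?I s * \<eta> s \<partial>?N)"
    using AE_indicator_unit by (intro integral_cong_AE) auto
  then have "\<eta> \<in> L2_W0 W"
    using mean integrable_mult_indicator[OF _ L2_integrable_power2[OF L], of "{0..1}"]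
    by (simp add: L2_W0_def set_borel_measurable_def set_integrable_def set_lebesgue_integral_def)
  then have "is_W_derivative W f \<eta>"
    using f_int by (simp add: is_W_derivative_def set_lebesgue_integral_def)
  moreover have "cadlag_on {0..1} f"
  proof (rule cadlag_on_indefinite_integral)
    show "integrable ?N (\<lambda>s. ?I s * \<eta> s)"
      by (rule L2_integrable_mult[OF step_in_L2_dW[OF 1] L])
    show "f x = (\<integral>s. indicator {0<..x} s * (?I s * \<eta> s) \<partial>?N)" if "x \<in> {0..1}" for x
      unfolding f_int[OF that]
      using that by (intro Bochner_Integration.integral_cong) (auto simp: indicator_def)
  qed simp
  ultimately show ?thesis
    using f f_int[of 0] f_int[of 1] mean by (auto simp: H_WD_def C_D_def)
qed

lemma inner_WD_eq:
  assumes F: "D_W W f \<in> L2_W0 W" and G: "D_W W g \<in> L2_W0 W"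
  shows "inner_WD W f g
    = (\<integral>s. (indicator {0<..1} s * D_W W f s) * (indicator {0<..1} s * D_W W g s) \<partial>interval_measure W)"
proof -
  have meas: "(\<lambda>s. indicator {0..1} s * H s) \<in> borel_measurable (interval_measure W)" if "H \<in> L2_W0 W" for H
    using that by (simp add: L2_W0_def set_borel_measurable_def)
  have "inner_WD W f g
    = (\<integral>s. (indicator {0..1} s * D_W W f s) * (indicator {0..1} s * D_W W g s) \<partial>interval_measure W)"
    unfolding inner_WD_def set_lebesgue_integral_def
    by (intro Bochner_Integration.integral_cong) (auto simp: indicator_def)
  also have "\<dots> = (\<integral>s. (indicator {0<..1} s * D_W W f s) * (indicator {0<..1} s * D_W W g s) \<partial>interval_measure W)"
    using AE_indicator_unit
    by (intro integral_cong_AE borel_measurable_times meas F G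
        L2_W0_restrict(1)[OF F, THEN L2_measurable] L2_W0_restrict(1)[OF G, THEN L2_measurable]) auto
  finally show ?thesis .
qed

end

section \<open>Centered Gaussian variables\<close>

lemma centered_gaussian_rv_moments:
  assumes "prob_space M" and Y: "centered_gaussian_rv M Y"
  shows "Y \<in> L2 M" and "(\<integral>\<omega>. Y \<omega> \<partial>M) = 0"
proof -
  interpret prob_space M by fact
  have meas [measurable]: "Y \<in> borel_measurable M"
    using Y by (simp add: centered_gaussian_rv_def)
  have "integrable M (\<lambda>\<omega>. (Y \<omega>)\<^sup>2) \<and> (\<integral>\<omega>. Y \<omega> \<partial>M) = 0"
  proof (cases "AE \<omega> in M. Y \<omega> = 0")
    case True
    then have "integrable M (\<lambda>\<omega>. (Y \<omega>)\<^sup>2) \<longleftrightarrow> integrable M (\<lambda>\<omega>. 0 :: real)"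
      by (intro integrable_cong_AE) auto
    moreover have "(\<integral>\<omega>. Y \<omega> \<partial>M) = (\<integral>\<omega>. 0 \<partial>M)"
      using True by (intro integral_cong_AE) auto
    ultimately show ?thesis by simp
  next
    case False
    then obtain \<sigma> where \<sigma>: "0 < \<sigma>" and D: "distributed M lborel Y (normal_density 0 \<sigma>)"
      using Y by (auto simp: centered_gaussian_rv_def)
    have "integrable M (\<lambda>\<omega>. (Y \<omega>)\<^sup>2)"
      using distributed_integrable[OF D, of "\<lambda>x. x\<^sup>2"] integrable_normal_moment[OF \<sigma>, of 0 2]
      by (simp add: normal_density_nonneg)
    then show ?thesis
      using normal_distributed_expectation[OF \<sigma> D] by simp
  qed
  then show "Y \<in> L2 M" "(\<integral>\<omega>. Y \<omega> \<partial>M) = 0"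
    by (simp_all add: L2_def)
qed

text \<open>Centered variables have their covariances as inner products.\<close>

lemma W_brownian_bridge_gram:
  assumes bridge: "W_brownian_bridge W M B"
  shows "\<And>t. t \<in> {0..1} \<Longrightarrow> B t \<in> L2 M"
    and "\<And>s t. s \<in> {0..1} \<Longrightarrow> t \<in> {0..1} \<Longrightarrow> (\<integral>\<omega>. B s \<omega> * B t \<omega> \<partial>M) = rho_W0 W s t"
proof -
  have gauss: "centered_gaussian_process M {0..1} B"
    and cov: "\<And>s t. s \<in> {0..1} \<Longrightarrow> t \<in> {0..1} \<Longrightarrow> cov M (B s) (B t) = rho_W0 W s t"
    using bridge by (auto simp: W_brownian_bridge_def)
  have prob: "prob_space M"
    using gauss by (simp add: centered_gaussian_process_def)
  have rv: "centered_gaussian_rv M (B t)" if "t \<in> {0..1}" for t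
  proof -
    have "centered_gaussian_rv M (\<lambda>\<omega>. \<Sum>u\<in>{t}. 1 * B u \<omega>)"
      using gauss that unfolding centered_gaussian_process_def
      by (elim conjE allE[of _ "{t}"] allE[of _ "\<lambda>_. 1"]) simp
    then show ?thesis by simp
  qed
  show "B t \<in> L2 M" if "t \<in> {0..1}" for t
    using centered_gaussian_rv_moments[OF prob rv[OF that]] by simp
  show "(\<integral>\<omega>. B s \<omega> * B t \<omega> \<partial>M) = rho_W0 W s t" if "s \<in> {0..1}" "t \<in> {0..1}" for s t
    using cov[OF that] centered_gaussian_rv_moments(2)[OF prob rv] that by (simp add: cov_def)
qed

section \<open>The Cameron--Martin space of the bridge\<close>

lemma cameron_martin_preimage_props:
  assumes "f \<in> cameron_martin_space M T X"
  shows "cameron_martin_preimage M T X f \<in> closed_span_L2 M T X"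
    and "\<And>t. t \<in> T \<Longrightarrow> (\<integral>\<omega>. cameron_martin_preimage M T X f \<omega> * X t \<omega> \<partial>M) = f t"
proof -
  let ?\<xi> = "cameron_martin_preimage M T X f"
  have "\<exists>\<xi>. \<xi> \<in> closed_span_L2 M T X \<and> cameron_martin_map M T X \<xi> = f"
    using assms by (auto simp: cameron_martin_space_def)
  then have \<xi>: "?\<xi> \<in> closed_span_L2 M T X \<and> cameron_martin_map M T X ?\<xi> = f"
    unfolding cameron_martin_preimage_def by (rule someI_ex)
  then show "?\<xi> \<in> closed_span_L2 M T X" ..
  show "(\<integral>\<omega>. ?\<xi> \<omega> * X t \<omega> \<partial>M) = f t" if "t \<in> T" for t
  proof -
    have "cameron_martin_map M T X ?\<xi> t = f t"
      using \<xi> by simp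
    then show ?thesis
      using that by (simp add: cameron_martin_map_def)
  qed
qed

lemma is_W_derivative_D_W: "f \<in> H_WD W \<Longrightarrow> is_W_derivative W f (D_W W f)"
  unfolding D_W_def by (rule someI_ex[of "is_W_derivative W f"]) (simp add: H_WD_def)

theorem proposition16:
  fixes W :: "real \<Rightarrow> real" and M :: "'a measure" and B :: "real \<Rightarrow> 'a \<Rightarrow> real"
  assumes W_strict_mono: "strict_mono W"
    and W_cadlag: "cadlag_on UNIV W"
    and W_periodic: "\<And>x. W (x + 1) - W x = W 1 - W 0"
    and W_cont_0: "isCont W 0"
    and W_0: "W 0 = 0"
    and bridge: "W_brownian_bridge W M B"
  shows "cameron_martin_space M {0..1} B = H_WD W \<and>
    (\<forall>f\<in>H_WD W. \<forall>g\<in>H_WD W. cameron_martin_inner M {0..1} B f g = inner_WD W f g)"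
proof -
  let ?N = "interval_measure W" and ?I = "indicator {0<..1} :: real \<Rightarrow> real"
  note W = W_strict_mono W_cadlag W_cont_0 W_0
  note B_L2 = W_brownian_bridge_gram(1)[OF bridge]
  note h_L2 = bridge_fun_in_L2[OF W]
  have gram: "(\<integral>\<omega>. B s \<omega> * B t \<omega> \<partial>M) = (\<integral>x. bridge_fun W s x * bridge_fun W t x \<partial>?N)"
    if "s \<in> {0..1}" "t \<in> {0..1}" for s t
    using W_brownian_bridge_gram(2)[OF bridge that] gram_bridge_fun[OF W that] by simp
  have subset: "f \<in> H_WD W" if "f \<in> cameron_martin_space M {0..1} B" for f
  proof -
    obtain \<xi> where \<xi>: "\<xi> \<in> closed_span_L2 M {0..1} B" and f: "f = cameron_martin_map M {0..1} B \<xi>"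
      using \<open>f \<in> _\<close> by (auto simp: cameron_martin_space_def)
    obtain \<eta> where \<eta>: "\<eta> \<in> closed_span_L2 ?N {0..1} (bridge_fun W)"
      and eq: "\<forall>\<phi>\<in>L2 M. \<forall>\<psi>\<in>L2 ?N.
        (\<forall>t\<in>{0..1}. (\<integral>\<omega>. \<phi> \<omega> * B t \<omega> \<partial>M) = (\<integral>x. \<psi> x * bridge_fun W t x \<partial>?N)) \<longrightarrow>
        (\<integral>\<omega>. \<xi> \<omega> * \<phi> \<omega> \<partial>M) = (\<integral>x. \<eta> x * \<psi> x \<partial>?N)"
      using closed_span_L2_transfer[OF B_L2 h_L2 gram \<xi>] ..
    show ?thesis
    proof (rule in_H_WD_if_bridge_span[OF W \<eta>])
      show "f \<in> extensional {0..1}"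
        by (simp add: f cameron_martin_map_def)
      fix t :: real assume t: "t \<in> {0..1}"
      then have "f t = (\<integral>\<omega>. \<xi> \<omega> * B t \<omega> \<partial>M)"
        by (simp add: f cameron_martin_map_def)
      also have "\<dots> = (\<integral>x. \<eta> x * bridge_fun W t x \<partial>?N)"
        by (intro eq[rule_format] B_L2 h_L2 gram t)
      finally show "f t = (\<integral>x. \<eta> x * bridge_fun W t x \<partial>?N)" .
    qed
  qed
  have supset: "f \<in> cameron_martin_space M {0..1} B" if f: "f \<in> H_WD W" for f
  proof -
    note F = W_derivative_in_bridge_span[OF W is_W_derivative_D_W[OF f]]
    obtain \<xi> where \<xi>: "\<xi> \<in> closed_span_L2 M {0..1} B"
      and eq: "\<forall>\<phi>\<in>L2 ?N. \<forall>\<psi>\<in>L2 M.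
        (\<forall>t\<in>{0..1}. (\<integral>x. \<phi> x * bridge_fun W t x \<partial>?N) = (\<integral>\<omega>. \<psi> \<omega> * B t \<omega> \<partial>M)) \<longrightarrow>
        (\<integral>x. ?I x * D_W W f x * \<phi> x \<partial>?N) = (\<integral>\<omega>. \<xi> \<omega> * \<psi> \<omega> \<partial>M)"
      using closed_span_L2_transfer[OF h_L2 B_L2 gram[symmetric] F(1)] ..
    have "f = cameron_martin_map M {0..1} B \<xi>"
    proof (rule extensionalityI)
      show "f \<in> extensional {0..1}"
        using f by (simp add: H_WD_def C_D_def)
      show "cameron_martin_map M {0..1} B \<xi> \<in> extensional {0..1}"
        by (simp add: cameron_martin_map_def)
      fix t :: real assume t: "t \<in> {0..1}"
      have "f t = (\<integral>x. ?I x * D_W W f x * bridge_fun W t x \<partial>?N)"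
        by (rule F(2)[OF t, symmetric])
      also have "\<dots> = (\<integral>\<omega>. \<xi> \<omega> * B t \<omega> \<partial>M)"
        by (intro eq[rule_format] B_L2 h_L2 gram[symmetric] t)
      finally show "f t = cameron_martin_map M {0..1} B \<xi> t"
        using t by (simp add: cameron_martin_map_def)
    qed
    with \<xi> show ?thesis
      by (simp add: cameron_martin_space_def)
  qed
  have inner: "cameron_martin_inner M {0..1} B f g = inner_WD W f g" if f: "f \<in> H_WD W" and g: "g \<in> H_WD W" for f g
  proof -
    note \<xi> = cameron_martin_preimage_props[OF supset[OF f]]
    note \<xi>' = cameron_martin_preimage_props[OF supset[OF g]]
    note DF = is_W_derivative_D_W[OF f] and DG = is_W_derivative_D_W[OF g]
    note F = W_derivative_in_bridge_span[OF W DF] and G = W_derivative_in_bridge_span[OF W DG]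
    have "cameron_martin_inner M {0..1} B f g
        = (\<integral>x. (?I x * D_W W f x) * (?I x * D_W W g x) \<partial>?N)"
      unfolding cameron_martin_inner_def
    proof (rule integral_mult_eq_if_same_coefficients[OF B_L2 h_L2 gram \<xi>(1) \<xi>'(1) F(1) G(1)])
      fix t :: real assume t: "t \<in> {0..1}"
      show "(\<integral>\<omega>. cameron_martin_preimage M {0..1} B f \<omega> * B t \<omega> \<partial>M)
          = (\<integral>x. ?I x * D_W W f x * bridge_fun W t x \<partial>?N)"
        using \<xi>(2)[OF t] F(2)[OF t] by simp
      show "(\<integral>\<omega>. cameron_martin_preimage M {0..1} B g \<omega> * B t \<omega> \<partial>M)
          = (\<integral>x. ?I x * D_W W g x * bridge_fun W t x \<partial>?N)"
        using \<xi>'(2)[OF t] G(2)[OF t] by simp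
    qed
    also have "\<dots> = inner_WD W f g"
      using DF DG by (intro inner_WD_eq[OF W, symmetric]) (simp_all add: is_W_derivative_def)
    finally show ?thesis .
  qed
  show ?thesis
    using subset supset inner by blast
qed

end
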